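(* Let $R>0$, $\alpha>2$ and let $A^\pm\subset\mathbb R^2$ be bounded domains. Then there are constants $c,C>0$ such that the following holds. If two functions $\mu^\pm=\mu^\pm(e^\pm,p^\pm)\in C^1_0(\mathbb R^2)$ with support in $A^\pm$ satisfy $$|\mu^\pm|,\ |\mu^\pm_e|,\ |\mu^\pm_p|\le c(1+|e^\pm|)^{-\alpha}$$ and a function $\psi^{ext}\in H^2_{loc}(\mathbb R)$ satisfies $$|\psi^{ext}(x)|\ge C(1+|x|^2)\quad\text{for }|x|\ge R,$$ then there are potentials $\phi^0,\psi^0\in H^2_{loc}(\mathbb R)$ such that $(\mu^\pm(e^\pm,p^\pm),\phi^0,\psi^0,\psi^{ext},\phi^{ext}=0)$ is an equilibrium of the $1.5d$ relativistic Vlasov-Maxwell equations with spatial support in $[-R,R]$, where $$e^\pm=\langle v\rangle\pm\phi^0(x),\qquad p^\pm=v_2\pm\psi^0(x)\pm\psi^{ext}(x).$$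
   Context: Here $x\in\mathbb R$, $v=(v_1,v_2)\in\mathbb R^2$, $\langle v\rangle=\sqrt{1+|v|^2}$, $\hat v=v/\langle v\rangle$; $\mu^\pm_e,\mu_p^\pm$ are the partial derivatives of $\mu^\pm$ in its first and second argument. The $1.5d$ relativistic Vlasov-Maxwell system with external fields $E_1^{ext}=-\partial_x\phi^{ext}$, $B^{ext}=\partial_x\psi^{ext}$ is $$\partial_tf^\pm+\hat v_1\partial_xf^\pm\pm(E_1+E_1^{ext}+\hat v_2(B+B^{ext}))\partial_{v_1}f^\pm\pm(E_2-\hat v_1(B+B^{ext}))\partial_{v_2}f^\pm=0,$$ $$\partial_tE_1=-j_1,\quad\partial_tE_2+\partial_xB=-j_2,\quad\partial_xE_1=\rho,\quad\partial_tB=-\partial_xE_2,$$ where $\rho=\int(f^+-f^-)\,dv$ and $j_i=\int\hat v_i(f^+-f^-)\,dv$. Saying that $(\mu^\pm(e^\pm,p^\pm),\phi^0,\psi^0,\psi^{ext},\phi^{ext})$ is an equilibrium means that $f^{0,\pm}(x,v)=\mu^\pm(e^\pm(x,v),p^\pm(x,v))$ together with $E_1^0=-\partial_x\phi^0$, $E_2^0=0$, $B^0=\partial_x\psi^0$ is a time-independent solution of this system. Spatial support in $[-R,R]$ means that $f^{0,\pm}(x,v)=0$ for $|x|>R$. *)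

theory Defs
  imports "HOL-Analysis.Analysis"
begin

section \<open>Function spaces\<close>

definition C1 :: "('a::real_normed_vector \<Rightarrow> 'b::real_normed_vector) \<Rightarrow> bool" where
  "C1 f \<longleftrightarrow> (\<exists>f' :: 'a \<Rightarrow> 'a \<Rightarrow>\<^sub>L 'b.
     (\<forall>z. (f has_derivative blinfun_apply (f' z)) (at z)) \<and> continuous_on UNIV f')"

definition fun_support :: "('a::topological_space \<Rightarrow> real) \<Rightarrow> 'a set" where
  "fun_support f = closure {z. f z \<noteq> 0}"

definition C1_0 :: "('a::real_normed_vector \<Rightarrow> real) \<Rightarrow> bool" where
  "C1_0 f \<longleftrightarrow> C1 f \<and> compact (fun_support f)"

definition test_function :: "(real \<Rightarrow> real) \<Rightarrow> bool" where
  "test_function \<eta> \<longleftrightarrow>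
     (\<forall>n x. ((deriv ^^ n) \<eta>) field_differentiable (at x)) \<and> compact (fun_support \<eta>)"

definition L2_loc :: "(real \<Rightarrow> real) \<Rightarrow> bool" where
  "L2_loc g \<longleftrightarrow> g \<in> borel_measurable borel \<and>
     (\<forall>a b. set_integrable lborel {a..b} (\<lambda>x. (g x)\<^sup>2))"

definition weak_deriv :: "(real \<Rightarrow> real) \<Rightarrow> (real \<Rightarrow> real) \<Rightarrow> bool" where
  "weak_deriv f g \<longleftrightarrow> (\<forall>\<eta>. test_function \<eta> \<longrightarrow>
     (LINT x|lborel. f x * deriv \<eta> x) = - (LINT x|lborel. g x * \<eta> x))"

text \<open>
  Elements of \<open>H\<^sup>2\<^sub>l\<^sub>o\<^sub>c(\<real>)\<close> are classes of functions equal almost everywhere. Every class has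
  exactly one continuous representative (which is even continuously differentiable), and as usual
  the class is identified with it. This is what gives pointwise statements a meaning, and makes
  \<open>deriv f\<close> the continuous representative of the first weak derivative.
\<close>

definition H2_loc :: "(real \<Rightarrow> real) \<Rightarrow> bool" where
  "H2_loc f \<longleftrightarrow> continuous_on UNIV f \<and> L2_loc f \<and>
     (\<exists>g h. L2_loc g \<and> L2_loc h \<and> weak_deriv f g \<and> weak_deriv g h)"

section \<open>The \<open>1.5d\<close> relativistic Vlasov-Maxwell system\<close>

definition jbracket :: "real \<times> real \<Rightarrow> real" where
  "jbracket v = sqrt (1 + (norm v)\<^sup>2)"

definition vhat :: "real \<times> real \<Rightarrow> real \<times> real" where
  "vhat v = v /\<^sub>R jbracket v"

abbreviation vhat1 :: "real \<times> real \<Rightarrow> real" where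
  "vhat1 v \<equiv> fst (vhat v)"

abbreviation vhat2 :: "real \<times> real \<Rightarrow> real" where
  "vhat2 v \<equiv> snd (vhat v)"

text \<open>
  Densities take the arguments \<open>t\<close>, \<open>x\<close>, \<open>v\<close>, self-consistent fields the arguments \<open>t\<close>, \<open>x\<close>.
  The species \<open>f\<^sup>+\<close>, \<open>f\<^sup>-\<close> are treated uniformly by means of the sign \<open>\<sigma> = 1\<close>, \<open>\<sigma> = -1\<close>.
\<close>

type_synonym density = "real \<Rightarrow> real \<Rightarrow> real \<times> real \<Rightarrow> real"
type_synonym field1d = "real \<Rightarrow> real \<Rightarrow> real"

definition vlasov_eq ::
  "real \<Rightarrow> density \<Rightarrow> field1d \<Rightarrow> field1d \<Rightarrow> field1d \<Rightarrow> (real \<Rightarrow> real) \<Rightarrow> (real \<Rightarrow> real) \<Rightarrow> bool" where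
  "vlasov_eq \<sigma> f E1 E2 B E1ext Bext \<longleftrightarrow> (\<forall>t x v1 v2.
     deriv (\<lambda>s. f s x (v1, v2)) t
     + vhat1 (v1, v2) * deriv (\<lambda>y. f t y (v1, v2)) x
     + \<sigma> * (E1 t x + E1ext x + vhat2 (v1, v2) * (B t x + Bext x)) * deriv (\<lambda>w. f t x (w, v2)) v1
     + \<sigma> * (E2 t x - vhat1 (v1, v2) * (B t x + Bext x)) * deriv (\<lambda>w. f t x (v1, w)) v2 = 0)"

definition charge_density :: "density \<Rightarrow> density \<Rightarrow> field1d" where
  "charge_density fp fm t x = (LINT v|lborel. fp t x v - fm t x v)"

definition current1 :: "density \<Rightarrow> density \<Rightarrow> field1d" where
  "current1 fp fm t x = (LINT v|lborel. vhat1 v * (fp t x v - fm t x v))"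

definition current2 :: "density \<Rightarrow> density \<Rightarrow> field1d" where
  "current2 fp fm t x = (LINT v|lborel. vhat2 v * (fp t x v - fm t x v))"

definition maxwell_eqs :: "density \<Rightarrow> density \<Rightarrow> field1d \<Rightarrow> field1d \<Rightarrow> field1d \<Rightarrow> bool" where
  "maxwell_eqs fp fm E1 E2 B \<longleftrightarrow> (\<forall>t x.
     deriv (\<lambda>s. E1 s x) t = - current1 fp fm t x \<and>
     deriv (\<lambda>s. E2 s x) t + deriv (\<lambda>y. B t y) x = - current2 fp fm t x \<and>
     deriv (\<lambda>y. E1 t y) x = charge_density fp fm t x \<and>
     deriv (\<lambda>s. B s x) t = - deriv (\<lambda>y. E2 t y) x)"

text \<open>
  Classical solutions. The \<open>C1\<close> conditions ensure that every \<open>deriv\<close> in the equations is a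
  genuine derivative. Integrability of the densities makes the velocity integrals meaningful,
  those of the currents included because \<open>|vhat v| < 1\<close>.
\<close>

definition RVM_solution ::
  "density \<Rightarrow> density \<Rightarrow> field1d \<Rightarrow> field1d \<Rightarrow> field1d \<Rightarrow> (real \<Rightarrow> real) \<Rightarrow> (real \<Rightarrow> real) \<Rightarrow> bool" where
  "RVM_solution fp fm E1 E2 B E1ext Bext \<longleftrightarrow>
     C1 (\<lambda>(t, x, v). fp t x v) \<and> C1 (\<lambda>(t, x, v). fm t x v) \<and>
     C1 (\<lambda>(t, x). E1 t x) \<and> C1 (\<lambda>(t, x). E2 t x) \<and> C1 (\<lambda>(t, x). B t x) \<and>
     (\<forall>t x. integrable lborel (fp t x) \<and> integrable lborel (fm t x)) \<and>
     vlasov_eq 1 fp E1 E2 B E1ext Bext \<and>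
     vlasov_eq (-1) fm E1 E2 B E1ext Bext \<and>
     maxwell_eqs fp fm E1 E2 B"

text \<open>
  \<open>f0p\<close>, \<open>f0m\<close> are the time-independent densities, as functions of \<open>x\<close> and \<open>v\<close>.
\<close>

definition RVM_equilibrium ::
  "(real \<Rightarrow> real \<times> real \<Rightarrow> real) \<Rightarrow> (real \<Rightarrow> real \<times> real \<Rightarrow> real) \<Rightarrow>
   (real \<Rightarrow> real) \<Rightarrow> (real \<Rightarrow> real) \<Rightarrow> (real \<Rightarrow> real) \<Rightarrow> (real \<Rightarrow> real) \<Rightarrow> bool" where
  "RVM_equilibrium f0p f0m \<phi>0 \<psi>0 \<psi>ext \<phi>ext \<longleftrightarrow>
     (\<forall>x. \<phi>0 differentiable (at x) \<and> \<psi>0 differentiable (at x) \<and>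
          \<psi>ext differentiable (at x) \<and> \<phi>ext differentiable (at x)) \<and>
     RVM_solution (\<lambda>t. f0p) (\<lambda>t. f0m)
       (\<lambda>t x. - deriv \<phi>0 x) (\<lambda>t x. 0) (\<lambda>t x. deriv \<psi>0 x)
       (\<lambda>x. - deriv \<phi>ext x) (\<lambda>x. deriv \<psi>ext x)"

definition spatial_support_in ::
  "(real \<Rightarrow> real \<times> real \<Rightarrow> real) \<Rightarrow> (real \<Rightarrow> real \<times> real \<Rightarrow> real) \<Rightarrow> real \<Rightarrow> bool" where
  "spatial_support_in f0p f0m R \<longleftrightarrow> (\<forall>x v. \<bar>x\<bar> > R \<longrightarrow> f0p x v = 0 \<and> f0m x v = 0)"

section \<open>Profiles depending on the microscopic energy and momentum\<close>

definition micro_energy :: "real \<Rightarrow> (real \<Rightarrow> real) \<Rightarrow> real \<Rightarrow> real \<times> real \<Rightarrow> real" where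
  "micro_energy \<sigma> \<phi>0 x v = jbracket v + \<sigma> * \<phi>0 x"

definition micro_momentum ::
  "real \<Rightarrow> (real \<Rightarrow> real) \<Rightarrow> (real \<Rightarrow> real) \<Rightarrow> real \<Rightarrow> real \<times> real \<Rightarrow> real" where
  "micro_momentum \<sigma> \<psi>0 \<psi>ext x v = snd v + \<sigma> * \<psi>0 x + \<sigma> * \<psi>ext x"

definition partial_e :: "(real \<times> real \<Rightarrow> real) \<Rightarrow> real \<Rightarrow> real \<Rightarrow> real" where
  "partial_e \<mu> e p = deriv (\<lambda>s. \<mu> (s, p)) e"

definition partial_p :: "(real \<times> real \<Rightarrow> real) \<Rightarrow> real \<Rightarrow> real \<Rightarrow> real" where
  "partial_p \<mu> e p = deriv (\<lambda>s. \<mu> (e, s)) p"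

definition decay_bound :: "real \<Rightarrow> real \<Rightarrow> (real \<times> real \<Rightarrow> real) \<Rightarrow> bool" where
  "decay_bound c \<alpha> \<mu> \<longleftrightarrow> (\<forall>e p.
     \<bar>\<mu> (e, p)\<bar> \<le> c * (1 + \<bar>e\<bar>) powr (-\<alpha>) \<and>
     \<bar>partial_e \<mu> e p\<bar> \<le> c * (1 + \<bar>e\<bar>) powr (-\<alpha>) \<and>
     \<bar>partial_p \<mu> e p\<bar> \<le> c * (1 + \<bar>e\<bar>) powr (-\<alpha>))"

definition bounded_domain :: "'a::real_normed_vector set \<Rightarrow> bool" where
  "bounded_domain A \<longleftrightarrow> open A \<and> connected A \<and> A \<noteq> {} \<and> bounded A"

end

theory Submission
  imports Defs
begin

text \<open>
  A density that depends on position and velocity only through the microscopic energy and momentum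
  solves the Vlasov equation automatically, because both quantities are conserved along the
  characteristics. Its current in the first direction vanishes by reflection of the first velocity
  component. What remains of the system are two ordinary differential equations: the second
  derivative of the electric potential \<open>\<phi>\<close> is minus the charge density, that of the magnetic
  potential \<open>\<psi>\<close> is minus the second component of the current (\<open>equilibrium_of_potentials\<close>). Both
  right-hand sides are velocity moments of the profiles and depend on \<open>x\<close> only through \<open>\<phi> x\<close> and
  \<open>\<psi> x + \<psi>ext x\<close>.

  These equations are solved by a contraction argument for the pair \<open>y\<close> of second derivatives, with
  potentials that vanish to first order at \<open>0\<close>. The external potential keeps the argument on a
  bounded interval: if \<open>\<bar>y\<bar> \<le> r\<close> with \<open>r \<le> 1\<close>, both potentials are at most \<open>x\<^sup>2\<close>. Let \<open>M\<close> bound the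
  supports of the profiles. A particle with admissible energy has \<open>\<bar>v2\<bar> \<le> M + \<bar>\<phi> x\<bar>\<close>, so its momentum
  is admissible only if \<open>\<bar>\<psi> x + \<psi>ext x\<bar> \<le> 2 * M + \<bar>\<phi> x\<bar>\<close>. For \<open>C = 2 * M + 2\<close> this is impossible at
  \<open>\<bar>x\<bar> \<ge> R\<close>. This gives the spatial support, and it shows that \<open>y\<close> has to be controlled on \<open>[- R, R]\<close>
  only. There \<open>r = 1 / (1 + R\<^sup>2)\<close> gives \<open>\<bar>\<phi>\<bar> \<le> 1\<close>, hence all particles have velocities in one fixed box,
  and the moments, together with their Lipschitz constants in the potentials, are bounded by \<open>c\<close> times
  the measure of this box. A small \<open>c\<close> therefore yields a contraction of a ball of bounded continuous
  functions into itself (\<open>self_consistent_potentials\<close>).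

  A classical solution has a continuously differentiable density. Since the density involves \<open>\<psi>ext\<close>,
  which is only given in \<open>H2_loc\<close>, its weak regularity has to be made classical. The lemma \<open>H2_loc_imp_C1\<close> does this. It tests the
  weak equations with smooth approximations of the Green's function of the second derivative on an
  interval, which leads to a representation of the function by its values at the end points and an
  integral of its second weak derivative.
\<close>

section \<open>Smooth functions on the real line\<close>

lemma antiderivative_exists:
  fixes f :: "real \<Rightarrow> real"
  assumes "continuous_on UNIV f"
  obtains F where "F a = 0" "\<And>x. (F has_real_derivative f x) (at x)"
proof -
  have "((\<lambda>u. LBINT y=a..u. f y) has_real_derivative f x) (at x)" for x
  proof -
    define l u where "l = min a x - 1" and "u = max a x + 1"
    have *: "((\<lambda>u. LBINT y=a..u. f y) has_vector_derivative f x) (at x within {l..u})"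
      by (rule interval_integral_FTC2) (auto simp: l_def u_def intro: continuous_on_subset[OF assms])
    have "at x within {l..u} = at x"
      by (rule at_within_interior) (auto simp: l_def u_def)
    with * show ?thesis by (simp add: has_real_derivative_iff_has_vector_derivative)
  qed
  then show ?thesis by (intro that[of "\<lambda>u. LBINT y=a..u. f y"]) auto
qed

definition smooth :: "(real \<Rightarrow> real) \<Rightarrow> bool" where
  "smooth f \<longleftrightarrow> (\<forall>n x. ((deriv ^^ n) f) field_differentiable (at x))"

text \<open>
  The working principle for smoothness: a family of differentiable functions that contains the
  derivative of each of its members consists of smooth functions. Linear combinations, products,
  affine substitutions and antiderivatives are treated by exhibiting such a family, so that no formula
  for a higher derivative is ever needed.
\<close>

lemma smooth_coinduct:
  assumes "f \<in> S" and step: "\<And>g. g \<in> S \<Longrightarrow> \<exists>g'\<in>S. \<forall>x. (g has_real_derivative g' x) (at x)"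
  shows "smooth f"
proof -
  have "(deriv ^^ n) f \<in> S" for n
  proof (induction n)
    case 0 then show ?case using assms by simp
  next
    case (Suc n)
    then obtain g' where g': "g' \<in> S" "\<And>x. ((deriv ^^ n) f has_real_derivative g' x) (at x)"
      using step by blast
    have "deriv ((deriv ^^ n) f) = g'"
      by (rule ext, rule DERIV_imp_deriv, rule g'(2))
    then show ?case using g' by simp
  qed
  then show ?thesis unfolding smooth_def field_differentiable_def using step by blast
qed

lemma smooth_deriv: "smooth f \<Longrightarrow> smooth (deriv f)"
  unfolding smooth_def
proof (intro allI)
  fix n x assume "\<forall>n x. (deriv ^^ n) f field_differentiable at x"
  then have "(deriv ^^ Suc n) f field_differentiable at x" by blast
  then show "(deriv ^^ n) (deriv f) field_differentiable at x"
    by (simp only: funpow_Suc_right o_def)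
qed

lemma smooth_has_deriv: "smooth f \<Longrightarrow> (f has_real_derivative deriv f x) (at x)"
  unfolding smooth_def by (metis DERIV_deriv_iff_field_differentiable funpow_0)

lemma smooth_continuous: "smooth f \<Longrightarrow> continuous_on UNIV f"
  by (meson DERIV_continuous continuous_at_imp_continuous_on smooth_has_deriv)

lemma smooth_antiderivative:
  assumes "\<And>x. (F has_real_derivative f x) (at x)" "smooth f"
  shows "smooth F"
  by (rule smooth_coinduct[of _ "insert F (Collect smooth)"])
     (use assms smooth_deriv smooth_has_deriv in blast)+

lemma smooth_lincomb:
  assumes "smooth f" "smooth g"
  shows "smooth (\<lambda>x. a * f x + b * g x)"
proof (rule smooth_coinduct[of _ "{\<lambda>x. a * f x + b * g x | f g. smooth f \<and> smooth g}"], goal_cases)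
  case 1 then show ?case using assms by blast
next
  case (2 u)
  then obtain f g where fg: "u = (\<lambda>x. a * f x + b * g x)" "smooth f" "smooth g" by blast
  then have "(u has_real_derivative a * deriv f x + b * deriv g x) (at x)" for x
    by (auto intro!: derivative_eq_intros smooth_has_deriv)
  then show ?case using fg smooth_deriv
    by (intro bexI[of _ "\<lambda>x. a * deriv f x + b * deriv g x"]) auto
qed

lemma smooth_affine:
  assumes "smooth f"
  shows "smooth (\<lambda>x. f (c * x + d))"
proof (rule smooth_coinduct[of _ "{\<lambda>x. a * f (c * x + d) | a f. smooth f}"], goal_cases)
  case 1 
  have "(\<lambda>x. f (c * x + d)) = (\<lambda>x. 1 * f (c * x + d))" by simp
  then show ?case using assms by blast
next
  case (2 u)
  then obtain a f where fg: "u = (\<lambda>x. a * f (c * x + d))" "smooth f" by blast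
  have "(u has_real_derivative (a * c) * deriv f (c * x + d)) (at x)" for x
  proof -
    have "((\<lambda>x. f (c * x + d)) has_real_derivative deriv f (c * x + d) * c) (at x)"
      by (rule DERIV_chain2[OF smooth_has_deriv[OF fg(2)]]) (auto intro!: derivative_eq_intros)
    from DERIV_cmult[OF this, of a] show ?thesis by (simp add: fg(1) mult_ac)
  qed
  then show ?case using fg smooth_deriv
    by (intro bexI[of _ "\<lambda>x. (a * c) * deriv f (c * x + d)"]) auto
qed

text \<open>
  Products alone are not stable under differentiation, because of the Leibniz rule; their finite
  sums are.
\<close>

inductive_set sums_of_products :: "(real \<Rightarrow> real) set" where
  prod: "smooth f \<Longrightarrow> smooth g \<Longrightarrow> (\<lambda>x. f x * g x) \<in> sums_of_products"
| add: "u \<in> sums_of_products \<Longrightarrow> v \<in> sums_of_products \<Longrightarrow> (\<lambda>x. u x + v x) \<in> sums_of_products"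

lemma smooth_mult:
  assumes "smooth f" "smooth g"
  shows "smooth (\<lambda>x. f x * g x)"
proof (rule smooth_coinduct[of _ sums_of_products], goal_cases)
  case 1 then show ?case using assms by (rule sums_of_products.prod)
next
  case (2 u)
  then show ?case
  proof induction
    case (prod f g)
    then have "((\<lambda>x. f x * g x) has_real_derivative deriv f x * g x + f x * deriv g x) (at x)" for x
      by (auto intro!: derivative_eq_intros smooth_has_deriv)
    then have "\<forall>x. ((\<lambda>x. f x * g x) has_real_derivative deriv f x * g x + f x * deriv g x) (at x)"
      by blast
    moreover have "(\<lambda>x. deriv f x * g x + f x * deriv g x) \<in> sums_of_products"
      using prod smooth_deriv by (intro sums_of_products.intros) auto
    ultimately show ?case by (rule bexI)
  next
    case (add u v)
    then obtain u' v' where "u' \<in> sums_of_products" "v' \<in> sums_of_products"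
      "\<And>x. (u has_real_derivative u' x) (at x)" "\<And>x. (v has_real_derivative v' x) (at x)" by blast
    then show ?case
      by (intro bexI[of _ "\<lambda>x. u' x + v' x"]) (auto intro: sums_of_products.intros DERIV_add)
  qed
qed

text \<open>
  The classical flat function \<open>exp (- 1 / x)\<close>, glued to \<open>0\<close> on the left half-line, with a
  polynomial factor in \<open>1 / x\<close>. The factor makes the family closed under differentiation.
\<close>

definition flat :: "real poly \<Rightarrow> real \<Rightarrow> real" where
  "flat P x = (if x > 0 then poly P (1 / x) * exp (- (1 / x)) else 0)"

lemma poly_times_exp_tendsto_0: "((\<lambda>t. poly P t * exp (- t)) \<longlongrightarrow> (0::real)) at_top"
proof -
  have "((\<lambda>t. \<Sum>i\<le>degree P. coeff P i * (t ^ i / exp t)) \<longlongrightarrow> (\<Sum>i\<le>degree P. coeff P i * 0)) at_top"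
    by (intro tendsto_intros tendsto_power_div_exp_0)
  then show ?thesis
    by (simp add: poly_altdef sum_distrib_right exp_minus divide_inverse mult.assoc)
qed

lemma flat_tendsto_0: "((flat P) \<longlongrightarrow> 0) (at 0)"
proof -
  have l: "((flat P) \<longlongrightarrow> 0) (at_left 0)"
    by (rule tendsto_eventually) (auto simp: flat_def eventually_at_left_field intro: exI[of _ "-1"])
  have "((\<lambda>x. poly P (1 / x) * exp (- (1 / x))) \<longlongrightarrow> 0) (at_right 0)"
    using filterlim_compose[OF poly_times_exp_tendsto_0 filterlim_inverse_at_top_right]
    by (simp add: divide_inverse)
  moreover have "eventually (\<lambda>x. poly P (1 / x) * exp (- (1 / x)) = flat P x) (at_right 0)"
    by (auto simp: flat_def eventually_at_right_field intro: exI[of _ 1])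
  ultimately have r: "((flat P) \<longlongrightarrow> 0) (at_right 0)"
    by (rule Lim_transform_eventually)
  from l r show ?thesis by (simp add: filterlim_at_split)
qed

lemma flat_has_deriv:
  "(flat P has_real_derivative flat ((P - pderiv P) * [:0, 0, 1:]) x) (at x)"
proof -
  consider "x > 0" | "x < 0" | "x = 0" by linarith
  then show ?thesis
  proof cases
    case 1
    have "((\<lambda>x. poly P (1 / x) * exp (- (1 / x))) has_real_derivative 
       flat ((P - pderiv P) * [:0, 0, 1:]) x) (at x)"
      unfolding flat_def using 1
      by (auto intro!: derivative_eq_intros DERIV_chain2[OF poly_DERIV] simp: field_simps)
    then show ?thesis
      by (rule has_field_derivative_transform_within_open[where S = "{0<..}"])
         (use 1 in \<open>auto simp: flat_def\<close>)
  next
    case 2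
    have "((\<lambda>x. 0) has_real_derivative flat ((P - pderiv P) * [:0, 0, 1:]) x) (at x)"
      using 2 by (simp add: flat_def)
    then show ?thesis
      by (rule has_field_derivative_transform_within_open[where S = "{..<0}"])
         (use 2 in \<open>auto simp: flat_def\<close>)
  next
    case 3
    have "(\<lambda>h. (flat P (0 + h) - flat P 0) / h) = flat (P * [:0, 1:])"
      by (rule ext) (auto simp: flat_def)
    then have "(flat P has_real_derivative 0) (at 0)"
      using flat_tendsto_0[of "P * [:0, 1:]"] unfolding DERIV_def by simp
    then show ?thesis using 3 by (simp add: flat_def)
  qed
qed

lemma smooth_flat: "smooth (flat P)"
  by (rule smooth_coinduct[of _ "range flat"]) (use flat_has_deriv in blast)+

text \<open>
  The smooth bump \<open>exp (- 1 / x - 1 / (1 - x))\<close> on \<open>(0, 1)\<close>, normalised to mass \<open>1\<close>, is integrated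
  twice. The second antiderivative \<open>T\<close> is a smooth substitute for the positive part: it agrees with
  it on the left half-line and differs from it by at most \<open>1\<close> elsewhere, so that
  \<open>T (N * x) / N\<close> tends to the positive part of \<open>x\<close> as \<open>N\<close> grows. To the right of \<open>1\<close> it is
  exactly affine, which lets combinations of translates cancel there.
\<close>

lemma smooth_ramp:
  obtains \<theta> \<Theta> T :: "real \<Rightarrow> real"
  where "smooth T" "\<And>x. (T has_real_derivative \<Theta> x) (at x)" "\<And>x. (\<Theta> has_real_derivative \<theta> x) (at x)"
    "\<And>x. \<theta> x \<ge> 0" "\<And>x. x \<le> 0 \<or> x \<ge> 1 \<Longrightarrow> \<theta> x = 0"
    "\<And>x. x \<le> 0 \<Longrightarrow> \<Theta> x = 0" "\<And>x. x \<ge> 1 \<Longrightarrow> \<Theta> x = 1"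
    "\<And>x. x \<le> 0 \<Longrightarrow> T x = 0" "\<And>x. x \<ge> 1 \<Longrightarrow> T x = x - (1 - T 1)" "\<And>x. \<bar>T x - max 0 x\<bar> \<le> 1"
proof -
  define b where "b x = flat 1 x * flat 1 (-1 * x + 1)" for x
  have b: "smooth b" unfolding b_def by (intro smooth_mult smooth_flat smooth_affine)
  have b_nonneg: "b x \<ge> 0" for x by (auto simp: b_def flat_def)
  have b_pos: "b x > 0" if "0 < x" "x < 1" for x using that by (auto simp: b_def flat_def)
  have b_0: "b x = 0" if "x \<le> 0 \<or> x \<ge> 1" for x using that by (auto simp: b_def flat_def)
  obtain B where B0: "B 0 = 0" and B: "\<And>x. (B has_real_derivative b x) (at x)"
    using antiderivative_exists[OF smooth_continuous[OF b], of 0] by blast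
  have const: "F x = F y" if "\<And>z. z \<in> {x..y} \<Longrightarrow> (F has_real_derivative 0) (at z)" "x \<le> y" for F :: "real \<Rightarrow> real" and x y
  proof (cases "x = y")
    case False
    have "continuous_on {x..y} F"
      using that(1) DERIV_isCont continuous_at_imp_continuous_on by blast
    then show ?thesis using DERIV_isconst_end[of x y F] that False by simp
  qed simp
  have mono: "F x \<le> F y" if "\<And>z. z \<in> {x..y} \<Longrightarrow> \<exists>d\<ge>0. (F has_real_derivative d) (at z)" "x \<le> y" for F :: "real \<Rightarrow> real" and x y
    using DERIV_nonneg_imp_nondecreasing[of x y F] that by auto
  have "B 0 < B 1"
    by (rule DERIV_pos_imp_increasing_open)
       (use B b_pos in \<open>auto intro!: DERIV_isCont continuous_at_imp_continuous_on\<close>)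
  then have B1: "B 1 > 0" using B0 by simp
  define \<theta> \<Theta> where "\<theta> x = b x / B 1" and "\<Theta> x = B x / B 1" for x
  have \<Theta>: "(\<Theta> has_real_derivative \<theta> x) (at x)" for x
    unfolding \<theta>_def \<Theta>_def by (intro DERIV_cdivide B)
  have "smooth \<theta>" using smooth_lincomb[OF b b, of "1 / B 1" 0] by (simp add: \<theta>_def[abs_def] divide_inverse mult.commute)
  then have "smooth \<Theta>" using \<Theta> smooth_antiderivative by blast
  obtain T where T0: "T 0 = 0" and T: "\<And>x. (T has_real_derivative \<Theta> x) (at x)"
    using antiderivative_exists[OF smooth_continuous[OF \<open>smooth \<Theta>\<close>], of 0] by blast
  have "smooth T" using T \<open>smooth \<Theta>\<close> smooth_antiderivative by blast
  have \<theta>0: "\<theta> x = 0" if "x \<le> 0 \<or> x \<ge> 1" for x using b_0[OF that] by (simp add: \<theta>_def)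
  have \<theta>_nonneg: "\<theta> x \<ge> 0" for x using b_nonneg B1 by (simp add: \<theta>_def)
  have \<Theta>_0: "\<Theta> x = 0" if "x \<le> 0" for x
  proof -
    have "\<Theta> x = \<Theta> 0"
    proof (rule const[OF _ that])
      fix z assume "z \<in> {x..0}"
      then show "(\<Theta> has_real_derivative 0) (at z)" using \<Theta>[of z] \<theta>0[of z] by simp
    qed
    then show ?thesis using B0 by (simp add: \<Theta>_def)
  qed
  have \<Theta>_1: "\<Theta> x = 1" if "x \<ge> 1" for x
  proof -
    have "\<Theta> 1 = \<Theta> x" 
    proof (rule const[OF _ that])
      fix z assume "z \<in> {1..x}"
      then show "(\<Theta> has_real_derivative 0) (at z)" using \<Theta>[of z] \<theta>0[of z] by simp
    qed
    then show ?thesis using B1 by (simp add: \<Theta>_def)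
  qed
  have \<Theta>_range: "0 \<le> \<Theta> x \<and> \<Theta> x \<le> 1" for x
  proof -
    have m: "\<Theta> x \<le> \<Theta> y" if "x \<le> y" for x y by (rule mono[OF _ that]) (use \<Theta> \<theta>_nonneg in blast)
    have "\<Theta> (min x 0) \<le> \<Theta> x" "\<Theta> x \<le> \<Theta> (max x 1)" by (rule m, simp)+
    then show ?thesis using \<Theta>_0[of "min x 0"] \<Theta>_1[of "max x 1"] by simp
  qed
  have T_0: "T x = 0" if "x \<le> 0" for x
  proof -
    have "T x = T 0"
    proof (rule const[OF _ that])
      fix z assume "z \<in> {x..0}"
      then show "(T has_real_derivative 0) (at z)" using T[of z] \<Theta>_0[of z] by simp
    qed
    then show ?thesis using T0 by simp
  qed
  have T_1: "T x = x - (1 - T 1)" if "x \<ge> 1" for x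
  proof -
    have "T 1 - 1 = T x - x"
    proof (rule const[OF _ that])
      fix z assume "z \<in> {1..x}"
      then have "\<Theta> z = 1" using \<Theta>_1 by simp
      with T[of z] show "((\<lambda>x. T x - x) has_real_derivative 0) (at z)"
        by (auto intro!: derivative_eq_intros)
    qed
    then show ?thesis by simp
  qed
  have "\<bar>T x - max 0 x\<bar> \<le> 1" for x
  proof -
    have *: "0 \<le> T x" "T x \<le> x" if "0 \<le> x" for x
    proof -
      show "0 \<le> T x" using mono[of 0 x T] T \<Theta>_range that T0 by auto
      have "0 - T 0 \<le> x - T x"
        by (rule mono[of 0 x "\<lambda>x. x - T x"])
           (use that \<Theta>_range in \<open>auto intro!: exI[of _ "1 - \<Theta> _"] derivative_eq_intros T\<close>)
      then show "T x \<le> x" using T0 by simp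
    qed
    show ?thesis
      using T_0[of x] T_1[of x] *[of x] *[of 1] by (cases "x \<le> 0"; cases "x \<ge> 1") auto
  qed
  with \<open>smooth T\<close> T \<Theta> \<theta>_nonneg \<theta>0 \<Theta>_0 \<Theta>_1 T_0 T_1 show thesis by (rule that) auto
qed

section \<open>Weak derivatives and classical differentiability\<close>

lemma test_function_iff: "test_function \<eta> \<longleftrightarrow> smooth \<eta> \<and> compact (fun_support \<eta>)"
  by (simp add: test_function_def smooth_def)

lemma integrable_continuous_compact_support:
  fixes f :: "'a::euclidean_space \<Rightarrow> real"
  assumes "continuous_on UNIV f" "compact S" "\<And>x. x \<notin> S \<Longrightarrow> f x = 0"
  shows "integrable lborel f"
proof -
  have "integrable lborel (\<lambda>x. indicator S x *\<^sub>R f x)"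
    using assms by (intro borel_integrable_compact) (auto intro: continuous_on_subset)
  also have "(\<lambda>x. indicator S x *\<^sub>R f x) = f"
    by (rule ext) (use assms(3) in \<open>auto simp: indicator_def\<close>)
  finally show ?thesis .
qed

lemma integral_of_deriv_compact_support:
  fixes F f :: "real \<Rightarrow> real"
  assumes "\<And>x. (F has_real_derivative f x) (at x)" "continuous_on UNIV f" "a \<le> b"
    "\<And>x. x \<notin> {a..b} \<Longrightarrow> f x = 0"
  shows "(LINT x|lborel. f x) = F b - F a"
proof -
  have "(LINT x|lborel. indicator {a..b} x *\<^sub>R f x) = F b - F a"
    using assms by (intro integral_FTC_atLeastAtMost)
      (auto intro: continuous_on_subset has_vector_derivative_at_within 
        simp: has_real_derivative_iff_has_vector_derivative)
  also have "(\<lambda>x. indicator {a..b} x *\<^sub>R f x) = f"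
    by (rule ext) (use assms(4) in \<open>auto simp: indicator_def\<close>)
  finally show ?thesis .
qed

text \<open>
  By Young's inequality \<open>\<bar>h\<bar> \<le> 1 + h\<^sup>2\<close>, and the constant is integrable over a bounded interval.
\<close>

lemma L2_loc_imp_set_integrable:
  assumes "L2_loc h"
  shows "set_integrable lborel {a..b} h"
proof -
  have [measurable]: "h \<in> borel_measurable borel" using assms by (simp add: L2_loc_def)
  have "set_integrable lborel {a..b} (\<lambda>x. 1 + (h x)\<^sup>2)"
    using assms by (intro set_integral_add) (auto simp: L2_loc_def borel_integrable_atLeastAtMost')
  then show ?thesis unfolding set_integrable_def
  proof (rule Bochner_Integration.integrable_bound)
    have "\<bar>h x\<bar> \<le> 1 + (h x)\<^sup>2" for x
      using sum_squares_bound[of 1 "\<bar>h x\<bar>"] by simp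
    then show "AE x in lborel. norm (indicat_real {a..b} x *\<^sub>R h x) \<le> norm (indicat_real {a..b} x *\<^sub>R (1 + (h x)\<^sup>2))"
      by (auto simp: indicator_def)
  qed simp
qed

lemma continuous_imp_L2_loc:
  assumes "continuous_on UNIV f"
  shows "L2_loc f"
  unfolding L2_loc_def
  using assms by (auto intro!: borel_measurable_continuous_onI borel_integrable_atLeastAtMost'
      continuous_intros continuous_on_subset[OF assms])

lemma compact_support_bounds:
  fixes \<eta> :: "real \<Rightarrow> real"
  assumes "compact (fun_support \<eta>)"
  obtains M where "M > 0" "\<And>x. \<bar>x\<bar> \<ge> M \<Longrightarrow> \<eta> x = 0"
proof -
  obtain M where M: "\<And>x. x \<in> fun_support \<eta> \<Longrightarrow> norm x \<le> M"
    using compact_imp_bounded[OF assms] unfolding bounded_iff by blast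
  have "\<eta> x = 0" if "\<bar>x\<bar> \<ge> \<bar>M\<bar> + 1" for x
  proof (rule ccontr)
    assume "\<eta> x \<noteq> 0"
    then have "x \<in> fun_support \<eta>" unfolding fun_support_def
      by (intro subsetD[OF closure_subset]) simp
    with M[of x] that show False by simp
  qed
  then show ?thesis by (intro that[of "\<bar>M\<bar> + 1"]) (simp_all add: add_nonneg_pos)
qed

text \<open>
  Integration by parts; the boundary terms vanish because the test function does.
\<close>

lemma weak_deriv_of_C1:
  assumes f: "\<And>x. (f has_real_derivative f' x) (at x)" and f': "continuous_on UNIV f'"
  shows "weak_deriv f f'"
  unfolding weak_deriv_def
proof (intro allI impI)
  fix \<eta> assume "test_function \<eta>"
  then have \<eta>: "smooth \<eta>" "compact (fun_support \<eta>)" by (auto simp: test_function_iff)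
  obtain M where M: "M > 0" "\<And>x. \<bar>x\<bar> \<ge> M \<Longrightarrow> \<eta> x = 0"
    using compact_support_bounds[OF \<eta>(2)] by blast
  have d0: "deriv \<eta> x = 0" if "x \<notin> {-M..M}" for x
  proof -
    have "(\<eta> has_real_derivative 0) (at x)"
      by (rule has_field_derivative_transform_within_open[of "\<lambda>_. 0" _ _ "- {-M..M}"])
         (use that M in auto)
    then show ?thesis by (rule DERIV_imp_deriv)
  qed
  have f0: "continuous_on UNIV f"
    by (intro continuous_at_imp_continuous_on ballI DERIV_isCont[OF f])
  note cont = smooth_continuous[OF \<eta>(1)] smooth_continuous[OF smooth_deriv[OF \<eta>(1)]]
  have i1: "integrable lborel (\<lambda>x. f x * deriv \<eta> x)"
    by (rule integrable_continuous_compact_support[of _ "{-M..M}"])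
       (use d0 in \<open>auto intro!: continuous_intros f0 cont\<close>)
  have i2: "integrable lborel (\<lambda>x. f' x * \<eta> x)"
    by (rule integrable_continuous_compact_support[of _ "{-M..M}"])
       (use M in \<open>auto intro!: continuous_intros f' cont\<close>)
  have "(LINT x|lborel. f x * deriv \<eta> x + f' x * \<eta> x) = f M * \<eta> M - f (- M) * \<eta> (- M)"
    by (rule integral_of_deriv_compact_support)
       (use M d0 in \<open>auto intro!: derivative_eq_intros f smooth_has_deriv \<eta> continuous_intros f0 f' cont\<close>)
  also have "\<dots> = 0" using M by simp
  finally show "(LINT x|lborel. f x * deriv \<eta> x) = - (LINT x|lborel. f' x * \<eta> x)"
    using i1 i2 by simp
qed

lemma C2_imp_H2_loc:
  assumes f: "\<And>x. (f has_real_derivative f' x) (at x)"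
    and f': "\<And>x. (f' has_real_derivative f'' x) (at x)" and f'': "continuous_on UNIV f''"
  shows "H2_loc f"
proof -
  have "continuous_on UNIV f" "continuous_on UNIV f'"
    by (intro continuous_at_imp_continuous_on ballI DERIV_isCont[OF f] DERIV_isCont[OF f'])+
  with f f' f'' show ?thesis
    unfolding H2_loc_def by (blast intro: continuous_imp_L2_loc weak_deriv_of_C1)
qed

text \<open>
  After the substitution \<open>s = a + y / (n + 1)\<close> the mollifier no longer depends on \<open>n\<close>, and dominated
  convergence applies.
\<close>

lemma mollification_tendsto:
  fixes u \<theta> :: "real \<Rightarrow> real"
  assumes u: "continuous_on UNIV u" and \<theta>: "continuous_on UNIV \<theta>" 
    and nonneg: "\<And>x. \<theta> x \<ge> 0" and supp: "\<And>x. x \<le> 0 \<or> x \<ge> 1 \<Longrightarrow> \<theta> x = 0"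
    and mass: "(LINT x|lborel. \<theta> x) = 1"
  shows "(\<lambda>n. LINT s|lborel. u s * (real (Suc n) * \<theta> (real (Suc n) * (s - a)))) \<longlonglongrightarrow> u a"
proof -
  have "compact (u ` {a..a+1})" 
    using u by (intro compact_continuous_image) (auto intro: continuous_on_subset)
  then obtain M where M: "\<And>x. x \<in> {a..a+1} \<Longrightarrow> norm (u x) \<le> M"
    by (meson bounded_iff compact_imp_bounded imageI)
  have "(\<lambda>n. LINT y|lborel. u (a + y / real (Suc n)) * \<theta> y) \<longlonglongrightarrow> (LINT y|lborel. u a * \<theta> y)"
  proof (rule integral_dominated_convergence)
    have I: "integrable lborel \<theta>"
      by (rule integrable_continuous_compact_support[OF \<theta>, of "{0..1}"]) (use supp in auto)
    then show "integrable lborel (\<lambda>y. M * \<theta> y)" by simp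
    have [measurable]: "u \<in> borel_measurable borel" "\<theta> \<in> borel_measurable borel"
      using u \<theta> by (auto intro: borel_measurable_continuous_onI)
    show "(\<lambda>y. u a * \<theta> y) \<in> borel_measurable lborel"
      "\<And>n. (\<lambda>y. u (a + y / real (Suc n)) * \<theta> y) \<in> borel_measurable lborel" by measurable
    have "norm (u (a + y / real (Suc n)) * \<theta> y) \<le> M * \<theta> y" for n y
    proof (cases "0 < y \<and> y < 1")
      case True
      then have "y \<le> 1 * real (Suc n)" by (simp add: algebra_simps)
      then have "y / real (Suc n) \<le> 1" by (subst pos_divide_le_eq) auto
      then have "\<bar>u (a + y / real (Suc n))\<bar> \<le> M" using M[of "a + y / real (Suc n)"] True by auto
      then show ?thesis using nonneg[of y] by (simp add: abs_mult mult_right_mono)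
    next
      case False
      then show ?thesis using supp[of y] by auto
    qed
    then show "AE y in lborel. norm (u (a + y / real (Suc n)) * \<theta> y) \<le> M * \<theta> y" for n by simp
    have "(\<lambda>n. u (a + y / real (Suc n)) * \<theta> y) \<longlonglongrightarrow> u a * \<theta> y" for y
    proof -
      have "(\<lambda>n. a + y * inverse (real (Suc n))) \<longlonglongrightarrow> a + y * 0"
        by (intro tendsto_intros LIMSEQ_inverse_real_of_nat)
      then have "(\<lambda>n. a + y / real (Suc n)) \<longlonglongrightarrow> a" by (simp add: divide_inverse)
      moreover have "isCont u a" using u by (simp add: continuous_on_eq_continuous_at)
      ultimately have "(\<lambda>n. u (a + y / real (Suc n))) \<longlonglongrightarrow> u a" 
        using isCont_tendsto_compose by blast
      then show ?thesis by (intro tendsto_intros)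
    qed
    then show "AE y in lborel. (\<lambda>n. u (a + y / real (Suc n)) * \<theta> y) \<longlonglongrightarrow> u a * \<theta> y" by simp
  qed
  moreover have "(LINT s|lborel. u s * (real (Suc n) * \<theta> (real (Suc n) * (s - a)))) 
     = (LINT y|lborel. u (a + y / real (Suc n)) * \<theta> y)" for n
    by (subst lborel_integral_real_affine[where c = "1 / real (Suc n)" and t = a])
       (simp_all del: of_nat_Suc add: field_simps flip: integral_mult_right_zero)
  ultimately show ?thesis using mass by simp
qed

text \<open>
  The integral is the solution of \<open>K'' = h\<close> that vanishes to the right of the support of \<open>h\<close>.
  For a merely integrable \<open>h\<close> the first derivative is still classical: as a function of \<open>x\<close> the
  kernel is Lipschitz with constant \<open>1\<close> and differentiable except at \<open>x = s\<close>, a null set of \<open>s\<close>.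
\<close>

lemma kernel_has_derivative:
  fixes h :: "real \<Rightarrow> real"
  assumes h: "integrable lborel h" and sh: "integrable lborel (\<lambda>s. s * h s)"
  defines "N x \<equiv> (LINT s|lborel. h s * indicator {x<..} s)"
  shows "((\<lambda>x. LINT s|lborel. h s * max 0 (s - x)) has_real_derivative - N x) (at x)"
    and "isCont N x"
    and "integrable lborel (\<lambda>s. h s * max 0 (s - x))"
proof -
  have [measurable]: "h \<in> borel_measurable borel" using h by simp
  show int: "integrable lborel (\<lambda>s. h s * max 0 (s - x))" for x
  proof (rule Bochner_Integration.integrable_bound)
    show "integrable lborel (\<lambda>s. \<bar>s * h s\<bar> + \<bar>x\<bar> * \<bar>h s\<bar>)" using h sh by simp
    have "norm (h s * max 0 (s - x)) \<le> norm (\<bar>s * h s\<bar> + \<bar>x\<bar> * \<bar>h s\<bar>)" for s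
    proof -
      have "\<bar>h s\<bar> * max 0 (s - x) \<le> \<bar>h s\<bar> * (\<bar>s\<bar> + \<bar>x\<bar>)" by (intro mult_left_mono) auto
      then show ?thesis by (simp add: abs_mult algebra_simps)
    qed
    then show "AE s in lborel. norm (h s * max 0 (s - x)) \<le> norm (\<bar>s * h s\<bar> + \<bar>x\<bar> * \<bar>h s\<bar>)" by simp
  qed simp
  show "isCont N x"
  proof (rule continuous_at_sequentiallyI)
    fix u assume u: "u \<longlonglongrightarrow> x"
    show "(\<lambda>n. N (u n)) \<longlonglongrightarrow> N x" unfolding N_def
    proof (rule integral_dominated_convergence[where w = "\<lambda>s. \<bar>h s\<bar>"])
      show "AE s in lborel. (\<lambda>n. h s * indicator {u n<..} s) \<longlonglongrightarrow> h s * indicator {x<..} s"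
        using AE_lborel_singleton[of x]
      proof eventually_elim
        case (elim s)
        have "\<forall>\<^sub>F n in sequentially. h s * indicator {x<..} s = h s * indicator {u n<..} s"
        proof (cases "x < s")
          case True
          have "\<forall>\<^sub>F n in sequentially. u n < s" using order_tendstoD(2)[OF u True] .
          then show ?thesis by eventually_elim (use True in \<open>auto simp: indicator_def\<close>)
        next
          case False
          have "\<forall>\<^sub>F n in sequentially. s < u n" using order_tendstoD(1)[OF u] False elim by simp
          then show ?thesis by eventually_elim (use False in \<open>auto simp: indicator_def\<close>)
        qed
        then show ?case by (rule Lim_transform_eventually[OF tendsto_const])
      qed
    qed (use h in \<open>auto simp: indicator_def\<close>)
  qed
  show "((\<lambda>x. LINT s|lborel. h s * max 0 (s - x)) has_real_derivative - N x) (at x)"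
    unfolding DERIV_def tendsto_at_iff_sequentially o_def
  proof (intro allI impI)
    fix u :: "nat \<Rightarrow> real" assume u0: "\<forall>i. u i \<in> UNIV - {0}" and u: "u \<longlonglongrightarrow> 0"
    have "(\<lambda>n. LINT s|lborel. h s * ((max 0 (s - (x + u n)) - max 0 (s - x)) / u n)) \<longlonglongrightarrow> 
        (LINT s|lborel. h s * - indicator {x<..} s)"
    proof (rule integral_dominated_convergence[where w = "\<lambda>s. \<bar>h s\<bar>"])
      show "AE s in lborel. (\<lambda>n. h s * ((max 0 (s - (x + u n)) - max 0 (s - x)) / u n)) \<longlonglongrightarrow> h s * - indicator {x<..} s"
        using AE_lborel_singleton[of x]
      proof eventually_elim
        case (elim s)
        have "\<forall>\<^sub>F n in sequentially. h s * - indicator {x<..} s = 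
                h s * ((max 0 (s - (x + u n)) - max 0 (s - x)) / u n)"
        proof (cases "x < s")
          case True
          have "\<forall>\<^sub>F n in sequentially. u n < s - x" using order_tendstoD(2)[OF u] True by simp
          then show ?thesis by eventually_elim (use True u0 in auto)
        next
          case False
          have "\<forall>\<^sub>F n in sequentially. s - x < u n" using order_tendstoD(1)[OF u] False elim by simp
          then show ?thesis by eventually_elim (use False u0 in auto)
        qed
        then show ?case by (rule Lim_transform_eventually[OF tendsto_const])
      qed
      have "norm (h s * ((max 0 (s - (x + u n)) - max 0 (s - x)) / u n)) \<le> \<bar>h s\<bar>" for s n
      proof -
        have "\<bar>max 0 (s - (x + u n)) - max 0 (s - x)\<bar> \<le> \<bar>u n\<bar>" by (simp add: max_def)
        then have "\<bar>(max 0 (s - (x + u n)) - max 0 (s - x)) / u n\<bar> \<le> 1" using u0 by (simp add: abs_divide divide_le_eq_1)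
        then show ?thesis using mult_left_mono[of _ 1 "\<bar>h s\<bar>"] by (simp add: abs_mult abs_divide flip: times_divide_eq_right)
      qed
      then show "AE s in lborel. norm (h s * ((max 0 (s - (x + u n)) - max 0 (s - x)) / u n)) \<le> \<bar>h s\<bar>" for n by simp
    qed (use h in auto)
    moreover have "(LINT s|lborel. h s * ((max 0 (s - (x + u n)) - max 0 (s - x)) / u n)) =
      ((LINT s|lborel. h s * max 0 (s - (x + u n))) - (LINT s|lborel. h s * max 0 (s - x))) / u n" for n
    proof -
      have "(LINT s|lborel. h s * ((max 0 (s - (x + u n)) - max 0 (s - x)) / u n)) =
        (LINT s|lborel. (h s * max 0 (s - (x + u n)) - h s * max 0 (s - x)) / u n)"
        by (simp add: right_diff_distrib)
      also have "\<dots> = (LINT s|lborel. h s * max 0 (s - (x + u n)) - h s * max 0 (s - x)) / u n" by simp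
      also have "(LINT s|lborel. h s * max 0 (s - (x + u n)) - h s * max 0 (s - x)) =
        (LINT s|lborel. h s * max 0 (s - (x + u n))) - (LINT s|lborel. h s * max 0 (s - x))"
        by (rule Bochner_Integration.integral_diff[OF int int])
      finally show ?thesis .
    qed
    ultimately have "(\<lambda>n. ((LINT s|lborel. h s * max 0 (s - (x + u n))) - (LINT s|lborel. h s * max 0 (s - x))) / u n)
       \<longlonglongrightarrow> (LINT s|lborel. h s * - indicator {x<..} s)" by (simp only:)
    then show "(\<lambda>n. ((LINT s|lborel. h s * max 0 (s - (x + u n))) - (LINT s|lborel. h s * max 0 (s - x))) / u n)
       \<longlonglongrightarrow> - N x"
      by (simp add: N_def)
  qed
qed

lemma integral_diff_scaled:
  fixes u v w :: "'a \<Rightarrow> real"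
  assumes "integrable M u" "integrable M v" "integrable M w"
  shows "(LINT s|M. u s - a * v s - b * w s) = (LINT s|M. u s) - a * (LINT s|M. v s) - b * (LINT s|M. w s)"
  using assms by simp

text \<open>
  The deviation of \<open>f\<close> from its secant through \<open>p\<close> and \<open>q\<close> is a Green's function applied to the weak
  second derivative. The same combination of point values becomes a legitimate test when the positive
  parts in the kernel are replaced by smooth ramps: the test function then has compact support,
  because the combination annihilates affine functions, and its second derivative is the
  corresponding combination of mollifiers, which converges to point evaluations of the continuous
  function \<open>f\<close>.
\<close>

lemma weak_second_deriv_secant:
  fixes f h :: "real \<Rightarrow> real"
  assumes f: "continuous_on UNIV f" and h: "L2_loc h"
    and weak: "\<And>\<eta>. test_function \<eta> \<Longrightarrow> (LINT s|lborel. f s * deriv (deriv \<eta>) s) = (LINT s|lborel. h s * \<eta> s)"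
    and x: "p \<le> x" "x \<le> q" and ab: "a \<ge> 0" "b \<ge> 0" "a + b = 1" "a * p + b * q = x"
  shows "f x - a * f p - b * f q = 
    (LINT s|lborel. h s * (max 0 (s - x) - a * max 0 (s - p) - b * max 0 (s - q)))"
proof -
  obtain \<theta> \<Theta> T :: "real \<Rightarrow> real" where 
    T: "smooth T" "\<And>x. (T has_real_derivative \<Theta> x) (at x)" and \<Theta>: "\<And>x. (\<Theta> has_real_derivative \<theta> x) (at x)"
    and nonneg: "\<And>x. \<theta> x \<ge> 0" and \<theta>0: "\<And>x. x \<le> 0 \<or> x \<ge> 1 \<Longrightarrow> \<theta> x = 0"
    and \<Theta>0: "\<And>x. x \<le> 0 \<Longrightarrow> \<Theta> x = 0" and \<Theta>1: "\<And>x. x \<ge> 1 \<Longrightarrow> \<Theta> x = 1"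
    and T0: "\<And>x. x \<le> 0 \<Longrightarrow> T x = 0" and T1: "\<And>x. x \<ge> 1 \<Longrightarrow> T x = x - (1 - T 1)"
    and T_approx: "\<And>x. \<bar>T x - max 0 x\<bar> \<le> 1"
    by (rule smooth_ramp) blast
  have "deriv T = \<Theta>" "deriv \<Theta> = \<theta>" using T(2) \<Theta> by (auto intro!: ext DERIV_imp_deriv)
  then have "smooth \<theta>" using smooth_deriv[OF smooth_deriv[OF T(1)]] by simp
  then have \<theta>_cont: "continuous_on UNIV \<theta>" by (rule smooth_continuous)
  have mass: "(LINT x|lborel. \<theta> x) = 1"
    using integral_of_deriv_compact_support[OF \<Theta> \<theta>_cont, of 0 1] \<theta>0 \<Theta>0 \<Theta>1 by force
  define K where "K s = max 0 (s - x) - a * max 0 (s - p) - b * max 0 (s - q)" for s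
  define N where "N n = real (Suc n)" for n
  have N: "N n \<ge> 1" for n by (simp add: N_def)
  define \<eta> where "\<eta> n s = (T (N n * (s - x)) - a * T (N n * (s - p)) - b * T (N n * (s - q))) / N n" for n s
  have ab1: "\<bar>a * u + b * v\<bar> \<le> c" if "\<bar>u\<bar> \<le> c" "\<bar>v\<bar> \<le> c" for u v c
  proof -
    have "\<bar>a * u + b * v\<bar> \<le> a * \<bar>u\<bar> + b * \<bar>v\<bar>"
      using abs_triangle_ineq[of "a * u" "b * v"] ab by (simp add: abs_mult)
    also have "\<dots> \<le> a * c + b * c" using that ab by (intro add_mono mult_left_mono) auto
    also have "\<dots> = c" using ab by (simp flip: distrib_right)
    finally show ?thesis .
  qed
  have outside: "\<eta> n s = 0" if "s \<notin> {p..q+1}" for n s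
  proof (cases "s < p")
    case True
    then have "N n * (s - x) \<le> 0" "N n * (s - p) \<le> 0" "N n * (s - q) \<le> 0"
      using N[of n] x by (auto simp: mult_le_0_iff)
    then show ?thesis by (simp add: \<eta>_def T0)
  next
    case False
    then have s: "s > q + 1" using that by auto
    have N1: "N n * y \<ge> 1" if "y \<ge> 1" for y using mult_mono[of 1 "N n" 1 y] N[of n] that by simp
    have "N n * (s - x) \<ge> 1" "N n * (s - p) \<ge> 1" "N n * (s - q) \<ge> 1"
      using s x by (auto intro!: N1)
    then have e: "T (N n * (s - x)) = N n * (s - x) - (1 - T 1)" "T (N n * (s - p)) = N n * (s - p) - (1 - T 1)" 
      "T (N n * (s - q)) = N n * (s - q) - (1 - T 1)" 
      using T1 by blast+
    \<comment> \<open>All three ramps are affine here; the combination cancels since \<open>a + b = 1\<close> and \<open>a * p + b * q = x\<close>.\<close>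
    have "b = 1 - a" using ab by simp
    have "x = a * p + (1 - a) * q" using ab by (simp add: \<open>b = 1 - a\<close>)
    show ?thesis unfolding \<eta>_def e unfolding \<open>b = 1 - a\<close> \<open>x = _\<close> by (simp add: algebra_simps)
  qed
  have d1: "(\<eta> n has_real_derivative \<Theta> (N n * (s - x)) - a * \<Theta> (N n * (s - p)) - b * \<Theta> (N n * (s - q))) (at s)" for n s
  proof -
    have *: "((\<lambda>s. T (N n * (s - y))) has_real_derivative \<Theta> (N n * (s - y)) * N n) (at s)" for y
      by (rule DERIV_chain2[OF T(2)]) (auto intro!: derivative_eq_intros)
    have "N n \<noteq> 0" using N[of n] by simp
    then have "(\<Theta> (N n * (s - x)) * N n - a * (\<Theta> (N n * (s - p)) * N n) - b * (\<Theta> (N n * (s - q)) * N n)) / N n =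
      \<Theta> (N n * (s - x)) - a * \<Theta> (N n * (s - p)) - b * \<Theta> (N n * (s - q))"
      by (simp add: diff_divide_distrib)
    with DERIV_cdivide[OF DERIV_diff[OF DERIV_diff[OF * DERIV_cmult[OF *]] DERIV_cmult[OF *]], of x a p b q "N n"]
    show ?thesis by (simp add: \<eta>_def[abs_def])
  qed
  have d2: "((\<lambda>s. \<Theta> (N n * (s - x)) - a * \<Theta> (N n * (s - p)) - b * \<Theta> (N n * (s - q))) has_real_derivative
     N n * \<theta> (N n * (s - x)) - a * (N n * \<theta> (N n * (s - p))) - b * (N n * \<theta> (N n * (s - q)))) (at s)" for n s
  proof -
    have *: "((\<lambda>s. \<Theta> (N n * (s - y))) has_real_derivative \<theta> (N n * (s - y)) * N n) (at s)" for y
      by (rule DERIV_chain2[OF \<Theta>]) (auto intro!: derivative_eq_intros)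
    show ?thesis 
      by (rule derivative_eq_intros * refl)+ (simp add: field_simps)
  qed
  have dd: "deriv (deriv (\<eta> n)) = (\<lambda>s. N n * \<theta> (N n * (s - x)) - a * (N n * \<theta> (N n * (s - p))) - b * (N n * \<theta> (N n * (s - q))))" for n
  proof -
    have "deriv (\<eta> n) = (\<lambda>s. \<Theta> (N n * (s - x)) - a * \<Theta> (N n * (s - p)) - b * \<Theta> (N n * (s - q)))"
      using d1 by (auto intro!: ext DERIV_imp_deriv)
    then show ?thesis using d2 by (auto intro!: ext DERIV_imp_deriv)
  qed
  have test: "test_function (\<eta> n)" for n
    unfolding test_function_iff
  proof
    have aff: "smooth (\<lambda>s. T (N n * (s - y)))" for y
      using smooth_affine[OF T(1), of "N n" "- (N n * y)"] by (simp add: right_diff_distrib)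
    have "smooth (\<lambda>s. (1 / N n) * (1 * T (N n * (s - x)) + (- a) * T (N n * (s - p))) + (- b / N n) * T (N n * (s - q)))"
      by (intro smooth_lincomb aff)
    then show "smooth (\<eta> n)" by (simp add: \<eta>_def[abs_def] diff_divide_distrib)
    have "fun_support (\<eta> n) \<subseteq> {p..q+1}" unfolding fun_support_def
      by (rule closure_minimal) (use outside in blast, simp)
    then show "compact (fun_support (\<eta> n))"
      by (metis bounded_subset bounded_closed_interval closed_closure compact_eq_bounded_closed fun_support_def)
  qed
  have int: "integrable lborel (\<lambda>s. f s * (N n * \<theta> (N n * (s - y))))" for n y
  proof (rule integrable_continuous_compact_support)
    show "continuous_on UNIV (\<lambda>s. f s * (N n * \<theta> (N n * (s - y))))"
      by (intro continuous_intros f continuous_on_compose2[OF \<theta>_cont]) auto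
    show "compact {y..y + 1}" by simp
    fix s assume "s \<notin> {y..y+1}"
    then consider "s - y \<le> 0" | "s - y \<ge> 1" by fastforce
    then have "N n * (s - y) \<le> 0 \<or> N n * (s - y) \<ge> 1"
    proof cases
      case 1 then show ?thesis using N[of n] by (auto simp: mult_le_0_iff)
    next
      case 2 then show ?thesis using mult_mono[of 1 "N n" 1 "s - y"] N[of n] by simp
    qed
    then show "f s * (N n * \<theta> (N n * (s - y))) = 0" using \<theta>0 by simp
  qed
  define L where "L n y = (LINT s|lborel. f s * (N n * \<theta> (N n * (s - y))))" for n y
  have "(LINT s|lborel. h s * \<eta> n s) = L n x - a * L n p - b * L n q" for n
  proof -
    have "(LINT s|lborel. h s * \<eta> n s) = (LINT s|lborel. f s * deriv (deriv (\<eta> n)) s)"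
      using weak[OF test] by simp
    also have "\<dots> = (LINT s|lborel. f s * (N n * \<theta> (N n * (s - x))) - a * (f s * (N n * \<theta> (N n * (s - p))))
       - b * (f s * (N n * \<theta> (N n * (s - q)))))"
      unfolding dd by (simp add: algebra_simps)
    also have "\<dots> = L n x - a * L n p - b * L n q"
      unfolding L_def
      by (rule integral_diff_scaled[OF int int int])
    finally show ?thesis .
  qed
  moreover have "(\<lambda>n. L n x - a * L n p - b * L n q) \<longlonglongrightarrow> f x - a * f p - b * f q"
    unfolding L_def N_def by (intro tendsto_intros mollification_tendsto f \<theta>_cont nonneg \<theta>0 mass)
  moreover have "(\<lambda>n. LINT s|lborel. h s * \<eta> n s) \<longlonglongrightarrow> (LINT s|lborel. h s * K s)"
  proof (rule integral_dominated_convergence[where w = "\<lambda>s. \<bar>indicator {p..q+1} s *\<^sub>R h s\<bar> * (2 * (q + 1 - p) + 2)"])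
    have [measurable]: "h \<in> borel_measurable borel" using h by (simp add: L2_loc_def)
    have [measurable]: "T \<in> borel_measurable borel" 
      using smooth_continuous[OF T(1)] by (rule borel_measurable_continuous_onI)
    show "(\<lambda>s. h s * K s) \<in> borel_measurable lborel" unfolding K_def by measurable
    show "(\<lambda>s. h s * \<eta> n s) \<in> borel_measurable lborel" for n unfolding \<eta>_def by measurable
    show "integrable lborel (\<lambda>s. \<bar>indicator {p..q+1} s *\<^sub>R h s\<bar> * (2 * (q + 1 - p) + 2))"
      using L2_loc_imp_set_integrable[OF h, of p "q + 1"] unfolding set_integrable_def 
      by (intro integrable_mult_left integrable_abs)
    have approx: "\<bar>\<eta> n s - K s\<bar> \<le> 2 / N n" for n s
    proof -
      define r where "r y = T (N n * (s - y)) - max 0 (N n * (s - y))" for y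
      have r: "\<bar>r y\<bar> \<le> 1" for y using T_approx by (simp add: r_def)
      have m: "max 0 (N n * y) = N n * max 0 y" for y
        using N[of n] by (auto simp: max_def mult_le_0_iff zero_le_mult_iff)
      have "\<eta> n s - K s = (r x - (a * r p + b * r q)) / N n"
        unfolding \<eta>_def K_def r_def m using N[of n] by (simp add: field_simps)
      moreover have "\<bar>r x - (a * r p + b * r q)\<bar> \<le> 2"
        using r[of x] ab1[OF r r, of p q] by linarith
      ultimately show ?thesis using N[of n] by (simp add: abs_divide divide_right_mono)
    qed
    have "(\<lambda>n. \<eta> n s) \<longlonglongrightarrow> K s" for s
    proof (rule LIM_zero_cancel, rule Lim_null_comparison)
      show "\<forall>\<^sub>F n in sequentially. norm (\<eta> n s - K s) \<le> 2 * inverse (real (Suc n))"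
        using approx[of _ s] by (simp add: N_def divide_inverse del: of_nat_Suc)
      have "(\<lambda>n. 2 * inverse (real (Suc n))) \<longlonglongrightarrow> 2 * 0"
        by (intro tendsto_intros LIMSEQ_inverse_real_of_nat)
      then show "(\<lambda>n. 2 * inverse (real (Suc n))) \<longlonglongrightarrow> 0" by simp
    qed
    then show "AE s in lborel. (\<lambda>n. h s * \<eta> n s) \<longlonglongrightarrow> h s * K s" by (auto intro!: tendsto_intros)
    have "norm (h s * \<eta> n s) \<le> \<bar>indicator {p..q+1} s *\<^sub>R h s\<bar> * (2 * (q + 1 - p) + 2)" for n s
    proof (cases "s \<in> {p..q+1}")
      case True
      define d where "d = q + 1 - p"
      have m: "\<bar>max 0 (s - y)\<bar> \<le> d" if "y \<in> {p, x, q}" for y using True x that by (auto simp: d_def)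
      have "\<bar>K s\<bar> \<le> 2 * d"
        using m[of x] ab1[OF m m, of p q] unfolding K_def by simp linarith
      moreover have "2 / N n \<le> 2" using N[of n] by (simp add: divide_le_eq)
      ultimately have "\<bar>\<eta> n s\<bar> \<le> 2 * d + 2" using approx[of n s] by linarith
      then show ?thesis using True by (simp add: abs_mult mult_left_mono d_def)
    qed (simp add: outside)
    then show "AE s in lborel. norm (h s * \<eta> n s) \<le> \<bar>indicator {p..q+1} s *\<^sub>R h s\<bar> * (2 * (q + 1 - p) + 2)" for n
      by simp
  qed
  ultimately show ?thesis unfolding K_def using LIMSEQ_unique by fastforce
qed

text \<open>
  On a bounded interval the secant formula represents \<open>f\<close> as an affine function plus the integral of
  \<open>kernel_has_derivative\<close>, applied to the truncation of the second weak derivative to that interval.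
  This turns the weak hypotheses on a potential into the classical differentiability that the
  equations require.
\<close>

lemma H2_loc_imp_C1:
  assumes "H2_loc f"
  shows "(f has_real_derivative deriv f x) (at x)" and "continuous_on UNIV (deriv f)"
proof -
  obtain g h where f: "continuous_on UNIV f" and gh: "L2_loc h" "weak_deriv f g" "weak_deriv g h"
    using assms unfolding H2_loc_def by blast
  have weak: "(LINT s|lborel. f s * deriv (deriv \<eta>) s) = (LINT s|lborel. h s * \<eta> s)" if \<eta>: "test_function \<eta>" for \<eta>
  proof -
    have "test_function (deriv \<eta>)"
      unfolding test_function_iff
    proof
      show "smooth (deriv \<eta>)" using \<eta> smooth_deriv by (auto simp: test_function_iff)
      have "deriv \<eta> z = 0" if "z \<notin> fun_support \<eta>" for z
      proof -
        have "(\<eta> has_real_derivative 0) (at z)"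
        proof (rule has_field_derivative_transform_within_open[of "\<lambda>_. 0" _ _ "- fun_support \<eta>"])
          show "0 = \<eta> y" if "y \<in> - fun_support \<eta>" for y
            using that closure_subset[of "{z. \<eta> z \<noteq> 0}"] unfolding fun_support_def by auto
        qed (use that in \<open>auto simp: fun_support_def\<close>)
        then show ?thesis by (rule DERIV_imp_deriv)
      qed
      then have "fun_support (deriv \<eta>) \<subseteq> fun_support \<eta>"
        unfolding fun_support_def[of "deriv \<eta>"] by (intro closure_minimal) (auto simp: fun_support_def)
      then show "compact (fun_support (deriv \<eta>))"
        using \<eta> unfolding test_function_iff
        by (metis bounded_subset closed_closure compact_eq_bounded_closed fun_support_def)
    qed
    with gh \<eta> show ?thesis unfolding weak_deriv_def by simp
  qed
  have local: "\<exists>f'. (\<forall>x. isCont f' x) \<and> (\<forall>x\<in>{p<..<q}. (f has_real_derivative f' x) (at x))" if "p < q" for p q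
  proof -
    \<comment> \<open>The Green's function is supported in \<open>{p..q}\<close>, so \<open>h\<close> may be truncated to this interval; the truncation is integrable.\<close>
    define k where "k s = indicator {p..q} s * h s" for s
    have k: "integrable lborel k"
      using L2_loc_imp_set_integrable[OF gh(1), of p q] by (simp add: k_def[abs_def] set_integrable_def)
    have [measurable]: "h \<in> borel_measurable borel" using gh by (simp add: L2_loc_def)
    have sk: "integrable lborel (\<lambda>s. s * k s)"
    proof (rule Bochner_Integration.integrable_bound)
      show "integrable lborel (\<lambda>s. (\<bar>p\<bar> + \<bar>q\<bar>) * k s)" using k by simp
      show "(\<lambda>s. s * k s) \<in> borel_measurable lborel" unfolding k_def by measurable
      show "AE s in lborel. norm (s * k s) \<le> norm ((\<bar>p\<bar> + \<bar>q\<bar>) * k s)"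
        by (auto simp: k_def indicator_def abs_mult intro!: mult_right_mono)
    qed
    define K where "K y = (LINT s|lborel. k s * max 0 (s - y))" for y
    define N where "N y = (LINT s|lborel. k s * indicator {y<..} s)" for y
    have K: "(K has_real_derivative - N y) (at y)" "isCont N y" "integrable lborel (\<lambda>s. k s * max 0 (s - y))" for y
      unfolding K_def N_def using kernel_has_derivative[OF k sk] by blast+
    have Kq: "K q = 0"
    proof -
      have "(\<lambda>s. k s * max 0 (s - q)) = (\<lambda>s. 0)" by (auto simp: k_def indicator_def)
      then show ?thesis by (simp add: K_def)
    qed
    define a b where "a x = (q - x) / (q - p)" and "b x = (x - p) / (q - p)" for x
    have rep: "f x = K x - a x * K p + a x * f p + b x * f q" if x: "x \<in> {p<..<q}" for x
    proof -
      have ab: "a x \<ge> 0" "b x \<ge> 0" "a x + b x = 1" "a x * p + b x * q = x"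
        using x by (auto simp: a_def b_def divide_simps) (auto simp: algebra_simps)
      have "f x - a x * f p - b x * f q = 
        (LINT s|lborel. h s * (max 0 (s - x) - a x * max 0 (s - p) - b x * max 0 (s - q)))"
        using x by (intro weak_second_deriv_secant[OF f gh(1) weak] ab) auto
      also have "\<dots> = (LINT s|lborel. k s * max 0 (s - x) - a x * (k s * max 0 (s - p)) - b x * (k s * max 0 (s - q)))"
      proof (rule Bochner_Integration.integral_cong)
        fix s
        show "h s * (max 0 (s - x) - a x * max 0 (s - p) - b x * max 0 (s - q)) =
          k s * max 0 (s - x) - a x * (k s * max 0 (s - p)) - b x * (k s * max 0 (s - q))"
        proof (cases "s \<in> {p..q}")
          case True then show ?thesis by (simp add: k_def algebra_simps)
        next
          case False
          then consider "s < p" | "s > q" by fastforce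
          then have "max 0 (s - x) - a x * max 0 (s - p) - b x * max 0 (s - q) = 0"
          proof cases
            case 1 then show ?thesis using x by simp
          next
            case 2
            have "a x * (s - p) + b x * (s - q) = (a x + b x) * s - (a x * p + b x * q)" by (simp add: algebra_simps)
            also have "\<dots> = s - x" by (simp only: ab mult_1)
            finally show ?thesis using 2 x that by simp
          qed
          with False show ?thesis by (simp add: k_def)
        qed
      qed simp
      also have "\<dots> = K x - a x * K p - b x * K q"
        unfolding K_def
        by (rule integral_diff_scaled[OF K(3) K(3) K(3)])
      finally show ?thesis by (simp add: Kq)
    qed
    define f' where "f' x = - N x + K p / (q - p) - f p / (q - p) + f q / (q - p)" for x
    have "(f has_real_derivative f' x) (at x)" if "x \<in> {p<..<q}" for x
    proof (rule has_field_derivative_transform_within_open[of "\<lambda>x. K x - a x * K p + a x * f p + b x * f q" _ _ "{p<..<q}"])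
      show "((\<lambda>x. K x - a x * K p + a x * f p + b x * f q) has_real_derivative f' x) (at x)"
      proof -
        have "(a has_real_derivative - 1 / (q - p)) (at x)" "(b has_real_derivative 1 / (q - p)) (at x)"
          unfolding a_def[abs_def] b_def[abs_def] using \<open>p < q\<close>
          by (auto intro!: derivative_eq_intros simp: divide_simps)
        from DERIV_add[OF DERIV_add[OF DERIV_diff[OF K(1) DERIV_cmult_right[OF this(1)]] DERIV_cmult_right[OF this(1)]]
            DERIV_cmult_right[OF this(2)], of "K p" "f p" "f q"]
        show ?thesis by (simp add: f'_def)
      qed
    qed (use rep that in auto)
    moreover have "isCont f' x" for x unfolding f'_def by (intro continuous_intros K)
    ultimately show ?thesis by blast
  qed
  have *: "(f has_real_derivative deriv f x) (at x) \<and> isCont (deriv f) x" for x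
  proof -
    have "x - 1 < x + 1" by simp
    from local[OF this] obtain f' where f': "\<And>x. isCont f' x"
      "\<And>y. y \<in> {x - 1<..<x + 1} \<Longrightarrow> (f has_real_derivative f' y) (at y)"
      by blast
    have eq: "f' y = deriv f y" if "y \<in> {x - 1<..<x + 1}" for y using f'(2)[OF that] DERIV_imp_deriv by fastforce
    have "\<forall>\<^sub>F y in nhds x. y \<in> {x - 1<..<x + 1}" by (intro eventually_nhds_in_open) auto
    then have "\<forall>\<^sub>F y in nhds x. f' y = deriv f y" by eventually_elim (rule eq)
    then have "isCont (deriv f) x" using f'(1)[of x] isCont_cong by blast
    then show ?thesis using f'(2)[of x] eq[of x] by simp
  qed
  show "(f has_real_derivative deriv f x) (at x)" "continuous_on UNIV (deriv f)"
    using * by (auto intro: continuous_at_imp_continuous_on)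
qed

section \<open>Continuously differentiable functions on phase space\<close>

lemma C1I:
  assumes "\<And>z. (f has_derivative blinfun_apply (f' z)) (at z)" "continuous_on UNIV f'"
  shows "C1 f"
  unfolding C1_def using assms by (intro exI[of _ f']) simp

lemma C1_imp_continuous:
  assumes "C1 f" shows "continuous_on UNIV f"
proof -
  obtain f' where f': "\<And>z. (f has_derivative blinfun_apply (f' z)) (at z)"
    using assms unfolding C1_def by blast
  show ?thesis by (intro continuous_at_imp_continuous_on ballI has_derivative_continuous[OF f'])
qed

lemma C1_bounded_linear:
  assumes "bounded_linear f" shows "C1 f"
  unfolding C1_def
proof (intro exI conjI allI)
  show "(f has_derivative blinfun_apply (Blinfun f)) (at z)" for z
    using assms by (simp add: bounded_linear_Blinfun_apply bounded_linear_imp_has_derivative)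
qed simp

lemma C1_compose:
  assumes "C1 f" "C1 g" shows "C1 (\<lambda>x. f (g x))"
proof -
  obtain f' where f': "\<And>z. (f has_derivative blinfun_apply (f' z)) (at z)" "continuous_on UNIV f'"
    using assms(1) unfolding C1_def by blast
  obtain g' where g': "\<And>z. (g has_derivative blinfun_apply (g' z)) (at z)" "continuous_on UNIV g'"
    using assms(2) unfolding C1_def by blast
  have "((\<lambda>x. f (g x)) has_derivative blinfun_apply (f' (g z) o\<^sub>L g' z)) (at z)" for z
    using has_derivative_compose[OF g'(1) f'(1)] by (simp add: blinfun_compose.rep_eq o_def)
  moreover have "continuous_on UNIV (\<lambda>z. f' (g z) o\<^sub>L g' z)"
    by (intro continuous_intros g' continuous_on_compose2[OF f'(2) C1_imp_continuous[OF assms(2)]]) auto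
  ultimately show ?thesis by (rule C1I)
qed

lemma C1_add:
  assumes "C1 f" "C1 g" shows "C1 (\<lambda>x. f x + g x)"
proof -
  obtain f' where f': "\<And>z. (f has_derivative blinfun_apply (f' z)) (at z)" "continuous_on UNIV f'"
    using assms(1) unfolding C1_def by blast
  obtain g' where g': "\<And>z. (g has_derivative blinfun_apply (g' z)) (at z)" "continuous_on UNIV g'"
    using assms(2) unfolding C1_def by blast
  have "((\<lambda>x. f x + g x) has_derivative blinfun_apply (f' z + g' z)) (at z)" for z
    using has_derivative_add[OF f'(1) g'(1)] by (simp add: plus_blinfun.rep_eq)
  moreover have "continuous_on UNIV (\<lambda>z. f' z + g' z)"
    by (intro continuous_intros g' f')
  ultimately show ?thesis by (rule C1I)
qed

lemma C1_cmult:
  fixes f :: "'a::real_normed_vector \<Rightarrow> real"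
  shows "C1 f \<Longrightarrow> C1 (\<lambda>x. c * f x)"
  by (rule C1_compose[OF C1_bounded_linear[OF bounded_linear_mult_right]])

lemma C1_Pair:
  assumes "C1 f" "C1 g" shows "C1 (\<lambda>x. (f x, g x))"
proof -
  have "C1 (\<lambda>u. (u, 0))" "C1 (\<lambda>u. (0, u))"
    by (intro C1_bounded_linear bounded_linear_Pair bounded_linear_ident bounded_linear_zero)+
  from C1_add[OF C1_compose[OF this(1) assms(1)] C1_compose[OF this(2) assms(2)]]
  show ?thesis by simp
qed

lemma C1_fst: "C1 fst" and C1_snd: "C1 snd"
  by (intro C1_bounded_linear bounded_linear_fst bounded_linear_snd)+

text \<open>
  Links the one-dimensional derivative, in which the potentials are handled, to the notion of
  continuous differentiability used for functions on phase space.
\<close>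

lemma C1_of_real_derivative:
  fixes f :: "real \<Rightarrow> real"
  assumes "\<And>x. (f has_real_derivative f' x) (at x)" "continuous_on UNIV f'"
  shows "C1 f"
  unfolding C1_def
proof (intro exI[of _ "\<lambda>x. blinfun_mult_right (f' x)"] conjI allI)
  show "(f has_derivative blinfun_apply (blinfun_mult_right (f' z))) (at z)" for z
    using assms(1)[of z] by (simp add: has_field_derivative_def)
  show "continuous_on UNIV (\<lambda>x. blinfun_mult_right (f' x))"
    by (intro continuous_intros assms)
qed

lemma jbracket_pos: "jbracket v > 0" and jbracket_ge_norm: "norm v \<le> jbracket v"
proof -
  show "jbracket v > 0" by (simp add: jbracket_def add_pos_nonneg)
  show "norm v \<le> jbracket v" unfolding jbracket_def by (rule real_le_rsqrt) simp
qed

lemma jbracket_ge_components: "\<bar>fst v\<bar> \<le> jbracket v" "\<bar>snd v\<bar> \<le> jbracket v"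
  using jbracket_ge_norm[of v] norm_fst_le[of "fst v" "snd v"] norm_snd_le[of "snd v" "fst v"] by auto

lemma jbracket_has_derivative: "(jbracket has_derivative (\<lambda>u. u \<bullet> vhat v)) (at v)"
proof -
  have j: "jbracket = (\<lambda>v. sqrt (1 + v \<bullet> v))" by (rule ext) (simp add: jbracket_def power2_norm_eq_inner)
  have "1 + v \<bullet> v > 0" by (simp add: add_pos_nonneg)
  then show ?thesis unfolding j
    by (auto intro!: derivative_eq_intros simp: vhat_def j inner_commute field_simps)
qed

lemma continuous_jbracket: "continuous_on S jbracket"
  unfolding jbracket_def by (intro continuous_intros)

lemma continuous_vhat: "continuous_on S vhat"
  unfolding vhat_def using jbracket_pos
  by (auto intro!: continuous_intros continuous_jbracket simp: less_imp_neq[symmetric])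

lemma C1_jbracket: "C1 jbracket"
  unfolding C1_def
proof (intro exI[of _ "\<lambda>v. blinfun_inner_left (vhat v)"] conjI allI)
  show "(jbracket has_derivative blinfun_apply (blinfun_inner_left (vhat v))) (at v)" for v
    using jbracket_has_derivative[of v] by simp
  show "continuous_on UNIV (\<lambda>x. blinfun_inner_left (vhat x))"
    by (intro continuous_intros continuous_vhat)
qed

lemma abs_vhat_le_1: "\<bar>vhat1 v\<bar> \<le> 1" "\<bar>vhat2 v\<bar> \<le> 1"
  using jbracket_ge_components[of v] jbracket_pos[of v] by (auto simp: vhat_def abs_mult divide_simps)

lemma chain_rule_pair:
  fixes \<mu> :: "real \<times> real \<Rightarrow> real"
  assumes "(\<mu> has_derivative D) (at (e t, p t))"
    "(e has_real_derivative e') (at t)" "(p has_real_derivative p') (at t)"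
  shows "((\<lambda>s. \<mu> (e s, p s)) has_real_derivative e' * D (1, 0) + p' * D (0, 1)) (at t)"
proof -
  have "((\<lambda>s. (e s, p s)) has_derivative (\<lambda>h. (e' * h, p' * h))) (at t)"
    using assms(2,3) by (intro has_derivative_Pair) (auto simp: has_field_derivative_def)
  from has_derivative_compose[OF this assms(1)]
  have "((\<lambda>s. \<mu> (e s, p s)) has_derivative (\<lambda>h. D (e' * h, p' * h))) (at t)" .
  moreover have "D (e' * h, p' * h) = (e' * D (1, 0) + p' * D (0, 1)) * h" for h
  proof -
    interpret bounded_linear D using assms(1) by (rule has_derivative_bounded_linear)
    have "(e' * h, p' * h) = (e' * h) *\<^sub>R (1, 0) + (p' * h) *\<^sub>R (0, 1)" by simp
    then show ?thesis by (simp only: add scaleR) (simp add: algebra_simps)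
  qed
  ultimately show ?thesis by (simp add: has_field_derivative_def)
qed

lemma jbracket_partial_derivs:
  "((\<lambda>w. jbracket (w, v2)) has_real_derivative vhat1 (v1, v2)) (at v1)"
  "((\<lambda>w. jbracket (v1, w)) has_real_derivative vhat2 (v1, v2)) (at v2)"
  using chain_rule_pair[OF jbracket_has_derivative, where e = "\<lambda>w. w" and t = v1 and p = "\<lambda>_. v2" and e' = 1 and p' = 0]
    chain_rule_pair[OF jbracket_has_derivative, where e = "\<lambda>_. v1" and t = v2 and p = "\<lambda>w. w" and e' = 0 and p' = 1]
  by (simp_all add: inner_prod_def)

section \<open>Velocity moments of compactly supported profiles\<close>

text \<open>
  The weight \<open>(1 + \<bar>e\<bar>) powr - \<alpha>\<close> is at most \<open>1\<close>. Since all profiles under consideration are supported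
  in one fixed bounded set, these uniform bounds already control their velocity moments.
\<close>

lemma decay_bound_imp_bounded:
  assumes "decay_bound c \<alpha> \<mu>" "\<alpha> \<ge> 0" "c \<ge> 0"
  shows "\<bar>\<mu> z\<bar> \<le> c" "\<bar>partial_e \<mu> e p\<bar> \<le> c" "\<bar>partial_p \<mu> e p\<bar> \<le> c"
proof -
  have *: "c * (1 + \<bar>e\<bar>) powr (-\<alpha>) \<le> c" for e
  proof -
    have "(1 + \<bar>e\<bar>) powr (-\<alpha>) \<le> (1 + \<bar>e\<bar>) powr 0" using assms by (intro powr_mono) auto
    also have "\<dots> = 1" by (simp add: add_nonneg_eq_0_iff)
    finally show ?thesis using assms mult_left_mono by fastforce
  qed
  show "\<bar>\<mu> z\<bar> \<le> c" "\<bar>partial_e \<mu> e p\<bar> \<le> c" "\<bar>partial_p \<mu> e p\<bar> \<le> c"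
    using assms(1) *[of e] *[of "fst z"] unfolding decay_bound_def
    by (metis order_trans surj_pair fst_conv)+
qed

lemma decay_bound_imp_Lipschitz:
  fixes \<mu> :: "real \<times> real \<Rightarrow> real"
  assumes \<mu>: "C1 \<mu>" and d: "decay_bound c \<alpha> \<mu>" "\<alpha> \<ge> 0" "c \<ge> 0"
  shows "\<bar>\<mu> (e, p) - \<mu> (e', p')\<bar> \<le> c * (\<bar>e - e'\<bar> + \<bar>p - p'\<bar>)"
proof -
  obtain D where D: "\<And>z. (\<mu> has_derivative blinfun_apply (D z)) (at z)"
    using \<mu> unfolding C1_def by blast
  have e: "((\<lambda>s. \<mu> (s, p)) has_real_derivative partial_e \<mu> s p) (at s)" for s p
    using chain_rule_pair[OF D, where e = "\<lambda>s. s" and t = s and p = "\<lambda>_. p" and e' = 1 and p' = 0] DERIV_imp_deriv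
    unfolding partial_e_def by fastforce
  have p: "((\<lambda>s. \<mu> (e, s)) has_real_derivative partial_p \<mu> e s) (at s)" for s e
    using chain_rule_pair[OF D, where e = "\<lambda>_. e" and t = s and p = "\<lambda>s. s" and e' = 0 and p' = 1] DERIV_imp_deriv
    unfolding partial_p_def by fastforce
  have "norm (\<mu> (e, p) - \<mu> (e', p)) \<le> c * norm (e - e')"
    by (rule field_differentiable_bound[of UNIV "\<lambda>s. \<mu> (s, p)"])
       (use e decay_bound_imp_bounded[OF d] in auto)
  moreover have "norm (\<mu> (e', p) - \<mu> (e', p')) \<le> c * norm (p - p')"
    by (rule field_differentiable_bound[of UNIV "\<lambda>s. \<mu> (e', s)"])
       (use p decay_bound_imp_bounded[OF d] in auto)
  ultimately show ?thesis by (simp add: distrib_left)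
qed

text \<open>
  For a profile evaluated at energy \<open>jbracket v + a\<close> and momentum \<open>snd v + b\<close>: weight \<open>1\<close> gives the
  charge density of a species and weight \<open>vhat2\<close> its current in the second direction. Only the numbers
  \<open>a\<close> and \<open>b\<close>, the values of the potentials at a point, enter.
\<close>

definition velocity_moment ::
  "(real \<times> real \<Rightarrow> real) \<Rightarrow> (real \<times> real \<Rightarrow> real) \<Rightarrow> real \<Rightarrow> real \<Rightarrow> real" where
  "velocity_moment w \<mu> a b = (LINT v|lborel. w v * \<mu> (jbracket v + a, snd v + b))"

definition velocity_box :: "real \<Rightarrow> (real \<times> real) set" where
  "velocity_box L = cbox (- L, - L) (L, L)"

text \<open>
  What the existence argument uses of \<open>\<mu>\<close>: size and Lipschitz constant are both at most \<open>c\<close>, which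
  will be small, while the support stays in a fixed square of half-width \<open>M\<close>.
\<close>

locale profile =
  fixes \<mu> :: "real \<times> real \<Rightarrow> real" and c M :: real
  assumes cont: "continuous_on UNIV \<mu>"
    and support: "\<mu> (e, p) \<noteq> 0 \<Longrightarrow> \<bar>e\<bar> \<le> M \<and> \<bar>p\<bar> \<le> M"
    and bounded: "\<bar>\<mu> z\<bar> \<le> c"
    and Lipschitz: "\<bar>\<mu> (e, p) - \<mu> (e', p')\<bar> \<le> c * (\<bar>e - e'\<bar> + \<bar>p - p'\<bar>)"
begin

lemma c_nonneg: "c \<ge> 0" using bounded[of undefined] by linarith

text \<open>
  An energy in the support confines the velocity, since \<open>\<bar>v\<bar> \<le> jbracket v\<close>.
\<close>

lemma vanishes_outside_box:
  assumes "\<bar>a\<bar> \<le> L" "v \<notin> velocity_box (M + L)"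
  shows "\<mu> (jbracket v + a, b) = 0"
proof (rule ccontr)
  assume "\<mu> (jbracket v + a, b) \<noteq> 0"
  then have "jbracket v \<le> M + L" using support assms(1) by fastforce
  then have "\<bar>fst v\<bar> \<le> M + L" "\<bar>snd v\<bar> \<le> M + L" using jbracket_ge_components[of v] by linarith+
  with assms(2) show False
    by (cases v) (auto simp: velocity_box_def cbox_Pair_eq)
qed

text \<open>
  The confinement mechanism: a particle whose energy lies in the support has \<open>\<bar>snd v\<bar> \<le> M + \<bar>a\<bar>\<close>, so
  a larger magnetic potential \<open>b\<close> cannot be compensated by \<open>snd v\<close>, and the momentum leaves the support.
\<close>

lemma vanishes_for_large_momentum:
  assumes "\<bar>b\<bar> > 2 * M + \<bar>a\<bar>"
  shows "\<mu> (jbracket v + a, snd v + b) = 0"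
proof (rule ccontr)
  assume "\<mu> (jbracket v + a, snd v + b) \<noteq> 0"
  then have "\<bar>jbracket v + a\<bar> \<le> M" "\<bar>snd v + b\<bar> \<le> M" using support by blast+
  then show False using assms jbracket_ge_components(2)[of v] by linarith
qed

lemma integrable_moment:
  assumes "continuous_on UNIV w"
  shows "integrable lborel (\<lambda>v. w v * \<mu> (jbracket v + a, snd v + b))"
proof (rule integrable_continuous_compact_support)
  show "continuous_on UNIV (\<lambda>v. w v * \<mu> (jbracket v + a, snd v + b))"
    by (intro continuous_intros assms continuous_on_compose2[OF cont] continuous_jbracket) auto
  show "compact (velocity_box (M + \<bar>a\<bar>))" by (simp add: velocity_box_def)
  show "w v * \<mu> (jbracket v + a, snd v + b) = 0" if "v \<notin> velocity_box (M + \<bar>a\<bar>)" for v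
    using vanishes_outside_box[OF _ that, of a] by simp
qed

lemma moment_integral_le:
  assumes g: "\<And>v. \<bar>g v\<bar> \<le> B" "\<And>v. v \<notin> velocity_box L \<Longrightarrow> g v = 0"
  shows "\<bar>LINT v|lborel. g v\<bar> \<le> B * measure lborel (velocity_box L)"
proof -
  have "\<bar>LINT v|lborel. g v\<bar> \<le> (LINT v|lborel. B * indicator (velocity_box L) v)"
  proof (cases "integrable lborel g")
    case True
    have "integrable lborel (indicat_real (velocity_box L))" unfolding velocity_box_def
      by (intro integrable_real_indicator emeasure_lborel_cbox_finite) simp
    then have i: "integrable lborel (\<lambda>v. B * indicator (velocity_box L) v)" by simp
    have "\<bar>LINT v|lborel. g v\<bar> \<le> (LINT v|lborel. \<bar>g v\<bar>)"
      using True integral_abs_bound by blast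
    also have "\<dots> \<le> (LINT v|lborel. B * indicator (velocity_box L) v)"
      by (rule integral_mono) (use True i g in \<open>auto simp: indicator_def\<close>)
    finally show ?thesis .
  next
    case False
    have "0 \<le> B" using g(1)[of undefined] by linarith
    then have "0 \<le> (LINT v|lborel. B * indicator (velocity_box L) v)" by (intro integral_nonneg_AE) auto
    then show ?thesis using not_integrable_integral_eq[OF False] by linarith
  qed
  then show ?thesis by (simp add: velocity_box_def)
qed

lemma moment_bound:
  assumes "\<And>v. \<bar>w v\<bar> \<le> 1" "\<bar>a\<bar> \<le> L"
  shows "\<bar>velocity_moment w \<mu> a b\<bar> \<le> c * measure lborel (velocity_box (M + L))"
  unfolding velocity_moment_def
proof (rule moment_integral_le)
  show "\<bar>w v * \<mu> (jbracket v + a, snd v + b)\<bar> \<le> c" for v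
    using mult_mono[OF assms(1)[of v] bounded] by (simp add: abs_mult)
qed (use vanishes_outside_box[OF assms(2)] in simp)

lemma moment_Lipschitz:
  assumes w: "continuous_on UNIV w" "\<And>v. \<bar>w v\<bar> \<le> 1" and a: "\<bar>a\<bar> \<le> L" "\<bar>a'\<bar> \<le> L"
  shows "\<bar>velocity_moment w \<mu> a b - velocity_moment w \<mu> a' b'\<bar> \<le> 
    c * (\<bar>a - a'\<bar> + \<bar>b - b'\<bar>) * measure lborel (velocity_box (M + L))"
proof -
  have "velocity_moment w \<mu> a b - velocity_moment w \<mu> a' b' = 
    (LINT v|lborel. w v * \<mu> (jbracket v + a, snd v + b) - w v * \<mu> (jbracket v + a', snd v + b'))"
    unfolding velocity_moment_def using integrable_moment[OF w(1)] by simp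
  also have "\<bar>\<dots>\<bar> \<le> c * (\<bar>a - a'\<bar> + \<bar>b - b'\<bar>) * measure lborel (velocity_box (M + L))"
  proof (rule moment_integral_le)
    fix v
    show "\<bar>w v * \<mu> (jbracket v + a, snd v + b) - w v * \<mu> (jbracket v + a', snd v + b')\<bar> \<le> c * (\<bar>a - a'\<bar> + \<bar>b - b'\<bar>)"
      using mult_mono[OF w(2)[of v] Lipschitz[of "jbracket v + a" "snd v + b" "jbracket v + a'" "snd v + b'"]]
      by (simp add: abs_mult flip: right_diff_distrib)
  qed (use vanishes_outside_box[OF a(1)] vanishes_outside_box[OF a(2)] in simp)
  finally show ?thesis .
qed

text \<open>
  The Lipschitz constant of a moment grows with the size of \<open>a\<close>, so continuity is argued locally.
\<close>

lemma continuous_moment: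
  assumes w: "continuous_on UNIV w" "\<And>v. \<bar>w v\<bar> \<le> 1"
    and f: "continuous_on UNIV f" and g: "continuous_on UNIV g"
  shows "continuous_on UNIV (\<lambda>x::real. velocity_moment w \<mu> (f x) (g x))"
proof (intro continuous_at_imp_continuous_on ballI)
  fix x0
  define L where "L = \<bar>f x0\<bar> + 1"
  have cf: "(f \<longlongrightarrow> f x0) (at x0)" and cg: "(g \<longlongrightarrow> g x0) (at x0)"
    using f g by (auto simp: continuous_on_eq_continuous_at isCont_def)
  have "((\<lambda>x. velocity_moment w \<mu> (f x) (g x)) \<longlongrightarrow> velocity_moment w \<mu> (f x0) (g x0)) (at x0)"
  proof (rule LIM_zero_cancel, rule Lim_null_comparison)
    have "\<forall>\<^sub>F x in at x0. \<bar>f x\<bar> < L"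
      using order_tendstoD(2)[OF tendsto_rabs[OF cf]] by (simp add: L_def)
    then show "\<forall>\<^sub>F x in at x0. norm (velocity_moment w \<mu> (f x) (g x) - velocity_moment w \<mu> (f x0) (g x0)) \<le>
       c * (\<bar>f x - f x0\<bar> + \<bar>g x - g x0\<bar>) * measure lborel (velocity_box (M + L))"
      by eventually_elim (auto intro!: moment_Lipschitz[OF w] simp: L_def)
    have "((\<lambda>x. c * (\<bar>f x - f x0\<bar> + \<bar>g x - g x0\<bar>) * measure lborel (velocity_box (M + L))) \<longlongrightarrow>
       c * (\<bar>f x0 - f x0\<bar> + \<bar>g x0 - g x0\<bar>) * measure lborel (velocity_box (M + L))) (at x0)"
      by (intro tendsto_intros cf cg)
    then show "((\<lambda>x. c * (\<bar>f x - f x0\<bar> + \<bar>g x - g x0\<bar>) * measure lborel (velocity_box (M + L))) \<longlongrightarrow> 0) (at x0)"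
      by simp
  qed
  then show "isCont (\<lambda>x. velocity_moment w \<mu> (f x) (g x)) x0" by (simp add: isCont_def)
qed

end

section \<open>Equilibria from potentials\<close>

text \<open>
  Used for the current in the first direction, which vanishes because a profile depends on the first
  velocity component only through \<open>jbracket\<close>. A non-integrable function has integral \<open>0\<close> by convention.
\<close>

lemma integral_odd_in_fst:
  fixes G :: "real \<times> real \<Rightarrow> real"
  assumes "\<And>v1 v2. G (- v1, v2) = - G (v1, v2)"
  shows "(LINT v|lborel. G v) = 0"
proof (cases "integrable lborel G")
  case True
  have "(LINT v1|lborel. G (v1, v2)) = 0" for v2
    using lborel_integral_real_affine[of "-1" "\<lambda>v1. G (v1, v2)" 0] assms by simp
  moreover have "(LINT v2|lborel. LINT v1|lborel. G (v1, v2)) = (LINT v|lborel. G v)"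
    using lborel_pair.integral_snd[of "\<lambda>x y. G (x, y)"] True by (simp add: lborel_prod)
  ultimately show ?thesis by simp
qed (simp add: not_integrable_integral_eq)

text \<open>
  Energy and momentum are conserved along the characteristics, so any function of the two solves the
  Vlasov equation: by the chain rule the coefficients of both partial derivatives of \<open>\<mu>\<close> cancel.
\<close>

lemma vlasov_eq_profile:
  assumes \<mu>: "C1 \<mu>" and \<phi>: "\<And>x. (\<phi> has_real_derivative \<phi>' x) (at x)"
    and \<psi>: "\<And>x. (\<psi> has_real_derivative \<psi>' x) (at x)" 
    and \<psi>ext: "\<And>x. (\<psi>ext has_real_derivative \<psi>ext' x) (at x)"
  shows "vlasov_eq \<sigma> (\<lambda>t x v. \<mu> (micro_energy \<sigma> \<phi> x v, micro_momentum \<sigma> \<psi> \<psi>ext x v))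
    (\<lambda>t x. - \<phi>' x) (\<lambda>t x. 0) (\<lambda>t. \<psi>') (\<lambda>x. 0) \<psi>ext'"
  unfolding vlasov_eq_def
proof (intro allI, goal_cases)
  case (1 t x v1 v2)
  obtain D where D: "\<And>z. (\<mu> has_derivative blinfun_apply (D z)) (at z)"
    using \<mu> unfolding C1_def by blast
  \<comment> \<open>The two partial derivatives of the profile at the given point are \<open>d (1, 0)\<close> and \<open>d (0, 1)\<close>.\<close>
  define d where "d = D (micro_energy \<sigma> \<phi> x (v1, v2), micro_momentum \<sigma> \<psi> \<psi>ext x (v1, v2))"
  have "deriv (\<lambda>y. \<mu> (micro_energy \<sigma> \<phi> y (v1, v2), micro_momentum \<sigma> \<psi> \<psi>ext y (v1, v2))) x
      = \<sigma> * \<phi>' x * d (1, 0) + (\<sigma> * \<psi>' x + \<sigma> * \<psi>ext' x) * d (0, 1)"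
    unfolding d_def
    by (rule DERIV_imp_deriv, rule chain_rule_pair[OF D])
       (auto simp: micro_energy_def micro_momentum_def intro!: derivative_eq_intros \<phi> \<psi> \<psi>ext)
  moreover have "deriv (\<lambda>w. \<mu> (micro_energy \<sigma> \<phi> x (w, v2), micro_momentum \<sigma> \<psi> \<psi>ext x (w, v2))) v1
      = vhat1 (v1, v2) * d (1, 0) + 0 * d (0, 1)"
    unfolding d_def
    by (rule DERIV_imp_deriv, rule chain_rule_pair[OF D])
       (auto simp: micro_energy_def micro_momentum_def intro!: derivative_eq_intros jbracket_partial_derivs)
  moreover have "deriv (\<lambda>w. \<mu> (micro_energy \<sigma> \<phi> x (v1, w), micro_momentum \<sigma> \<psi> \<psi>ext x (v1, w))) v2
      = vhat2 (v1, v2) * d (1, 0) + 1 * d (0, 1)"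
    unfolding d_def
    by (rule DERIV_imp_deriv, rule chain_rule_pair[OF D])
       (auto simp: micro_energy_def micro_momentum_def intro!: derivative_eq_intros jbracket_partial_derivs)
  ultimately show ?case by (simp add: algebra_simps)
qed

lemma C1_density:
  assumes "C1 \<mu>" "C1 \<phi>" "C1 \<psi>" "C1 \<psi>ext"
  shows "C1 (\<lambda>(t::real, x, v). \<mu> (micro_energy \<sigma> \<phi> x v, micro_momentum \<sigma> \<psi> \<psi>ext x v))"
  unfolding micro_energy_def micro_momentum_def case_prod_unfold
  by (intro C1_compose[OF assms(1)] C1_Pair C1_add C1_cmult C1_compose[OF assms(2)] C1_compose[OF assms(3)]
      C1_compose[OF assms(4)] C1_compose[OF C1_jbracket] C1_compose[OF C1_fst] C1_compose[OF C1_snd] C1_snd)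

text \<open>
  Reduction of the whole system to two ordinary differential equations for the potentials, the
  stationary Gauss and Ampere laws. Signs and arguments for the negative species follow from
  \<open>\<sigma> = -1\<close>, which reflects both potentials.
\<close>

lemma equilibrium_of_potentials:
  assumes \<mu>: "C1 \<mu>p" "C1 \<mu>m" and prof: "profile \<mu>p cp Mp" "profile \<mu>m cm Mm"
    and \<phi>: "\<And>x. (\<phi> has_real_derivative \<phi>' x) (at x)" "\<And>x. (\<phi>' has_real_derivative \<phi>'' x) (at x)"
    and \<psi>: "\<And>x. (\<psi> has_real_derivative \<psi>' x) (at x)" "\<And>x. (\<psi>' has_real_derivative \<psi>'' x) (at x)"
    and cont: "continuous_on UNIV \<phi>''" "continuous_on UNIV \<psi>''"
    and \<psi>ext: "\<And>x. (\<psi>ext has_real_derivative \<psi>ext' x) (at x)" "continuous_on UNIV \<psi>ext'"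
    and field_eqs: "\<And>x. \<phi>'' x = - (velocity_moment (\<lambda>v. 1) \<mu>p (\<phi> x) (\<psi> x + \<psi>ext x) - 
        velocity_moment (\<lambda>v. 1) \<mu>m (- \<phi> x) (- (\<psi> x + \<psi>ext x)))"
      "\<And>x. \<psi>'' x = - (velocity_moment vhat2 \<mu>p (\<phi> x) (\<psi> x + \<psi>ext x) - 
        velocity_moment vhat2 \<mu>m (- \<phi> x) (- (\<psi> x + \<psi>ext x)))"
  defines "fp x v \<equiv> \<mu>p (micro_energy 1 \<phi> x v, micro_momentum 1 \<psi> \<psi>ext x v)"
    and "fm x v \<equiv> \<mu>m (micro_energy (-1) \<phi> x v, micro_momentum (-1) \<psi> \<psi>ext x v)"
  shows "RVM_equilibrium fp fm \<phi> \<psi> \<psi>ext (\<lambda>x. 0)"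
proof -
  interpret p: profile \<mu>p cp Mp by fact
  interpret m: profile \<mu>m cm Mm by fact
  have deriv_eqs: "deriv \<phi> = \<phi>'" "deriv \<psi> = \<psi>'" "deriv \<psi>ext = \<psi>ext'"
    using \<phi>(1) \<psi>(1) \<psi>ext(1) by (auto intro!: ext DERIV_imp_deriv)
  have cont': "continuous_on UNIV \<phi>'" "continuous_on UNIV \<psi>'"
    by (intro continuous_at_imp_continuous_on ballI DERIV_isCont[OF \<phi>(2)] DERIV_isCont[OF \<psi>(2)])+
  have C1: "C1 \<phi>" "C1 \<psi>" "C1 \<psi>ext" "C1 \<phi>'" "C1 \<psi>'"
    by (rule C1_of_real_derivative, fact, fact)+
  have fp: "fp = (\<lambda>x v. \<mu>p (jbracket v + \<phi> x, snd v + (\<psi> x + \<psi>ext x)))"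
    by (intro ext) (simp add: fp_def micro_energy_def micro_momentum_def add.assoc)
  have fm: "fm = (\<lambda>x v. \<mu>m (jbracket v + - \<phi> x, snd v + - (\<psi> x + \<psi>ext x)))"
    by (intro ext) (simp add: fm_def micro_energy_def micro_momentum_def algebra_simps)
  have moments: "(LINT v|lborel. w v * (fp x v - fm x v)) = velocity_moment w \<mu>p (\<phi> x) (\<psi> x + \<psi>ext x) - 
        velocity_moment w \<mu>m (- \<phi> x) (- (\<psi> x + \<psi>ext x))" if "continuous_on UNIV w" for w x
    unfolding fp fm velocity_moment_def right_diff_distrib
    by (rule Bochner_Integration.integral_diff[OF p.integrable_moment[OF that] m.integrable_moment[OF that]])
  have j1: "current1 (\<lambda>t. fp) (\<lambda>t. fm) t x = 0" for t x
    unfolding current1_def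
    by (rule integral_odd_in_fst) (simp add: fp fm vhat_def jbracket_def norm_Pair)
  have j2: "current2 (\<lambda>t. fp) (\<lambda>t. fm) t x = - \<psi>'' x" for t x
    unfolding current2_def field_eqs
    by (subst moments) (auto intro!: continuous_intros continuous_vhat)
  have rho: "charge_density (\<lambda>t. fp) (\<lambda>t. fm) t x = - \<phi>'' x" for t x
    unfolding charge_density_def field_eqs using moments[of "\<lambda>_. 1" x] by simp
  have "integrable lborel (fp x)" "integrable lborel (fm x)" for x
    using p.integrable_moment[of "\<lambda>_. 1" "\<phi> x" "\<psi> x + \<psi>ext x"] 
      m.integrable_moment[of "\<lambda>_. 1" "- \<phi> x" "- (\<psi> x + \<psi>ext x)"] by (simp_all add: fp fm)
  moreover have "deriv (\<lambda>y. - \<phi>' y) x = - \<phi>'' x" "deriv \<psi>' x = \<psi>'' x" for x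
    by (auto intro!: DERIV_imp_deriv \<psi> DERIV_minus \<phi>)
  moreover have "vlasov_eq 1 (\<lambda>t. fp) (\<lambda>t x. - \<phi>' x) (\<lambda>t x. 0) (\<lambda>t. \<psi>') (\<lambda>x. 0) \<psi>ext'"
    "vlasov_eq (-1) (\<lambda>t. fm) (\<lambda>t x. - \<phi>' x) (\<lambda>t x. 0) (\<lambda>t. \<psi>') (\<lambda>x. 0) \<psi>ext'"
    using vlasov_eq_profile[OF \<mu>(1) \<phi>(1) \<psi>(1) \<psi>ext(1), of 1] 
      vlasov_eq_profile[OF \<mu>(2) \<phi>(1) \<psi>(1) \<psi>ext(1), of "-1"]
    by (simp_all add: fp_def[abs_def] fm_def[abs_def])
  moreover have "C1 (\<lambda>(t::real, x, v). fp x v)" "C1 (\<lambda>(t::real, x, v). fm x v)"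
    unfolding fp_def fm_def by (intro C1_density \<mu> C1)+
  moreover have "C1 (\<lambda>(t::real, x). - \<phi>' x)" "C1 (\<lambda>(t::real, x::real). 0::real)" "C1 (\<lambda>(t::real, x). \<psi>' x)"
    unfolding case_prod_unfold
    using C1_cmult[OF C1_compose[OF C1(4) C1_snd], of "-1"] C1_compose[OF C1(5) C1_snd]
      C1_bounded_linear[OF bounded_linear_zero] by simp_all
  moreover have "\<phi> differentiable (at x)" "\<psi> differentiable (at x)" "\<psi>ext differentiable (at x)" for x
    using \<phi>(1) \<psi>(1) \<psi>ext(1) real_differentiable_def by blast+
  ultimately show ?thesis
    unfolding RVM_equilibrium_def RVM_solution_def maxwell_eqs_def deriv_eqs
    by (simp add: j1 j2 rho)
qed

section \<open>Self-consistent potentials as a fixed point\<close>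

lemma abs_le_of_deriv_le:
  fixes F :: "real \<Rightarrow> real"
  assumes "F 0 = 0" "\<And>x. (F has_real_derivative f x) (at x)" "\<And>s. \<bar>s\<bar> \<le> \<bar>x\<bar> \<Longrightarrow> \<bar>f s\<bar> \<le> B"
  shows "\<bar>F x\<bar> \<le> B * \<bar>x\<bar>"
proof -
  have "norm (F x - F 0) \<le> B * norm (x - 0)"
    by (rule field_differentiable_bound[of "{-\<bar>x\<bar>..\<bar>x\<bar>}" F f])
       (use assms in \<open>auto intro: has_field_derivative_at_within\<close>)
  then show ?thesis using assms(1) by simp
qed

text \<open>
  The antiderivative vanishing at \<open>0\<close>; choosing it by its characteristic property treats both
  half-lines at once.
\<close>

definition antiderivative :: "(real \<Rightarrow> real) \<Rightarrow> real \<Rightarrow> real" where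
  "antiderivative f = (SOME F. F 0 = 0 \<and> (\<forall>x. (F has_real_derivative f x) (at x)))"

lemma antiderivative:
  assumes "continuous_on UNIV f"
  shows "antiderivative f 0 = 0" "(antiderivative f has_real_derivative f x) (at x)"
proof -
  have "\<exists>F. F 0 = 0 \<and> (\<forall>x. (F has_real_derivative f x) (at x))"
    by (rule antiderivative_exists[OF assms, of 0]) blast
  from someI_ex[OF this] show "antiderivative f 0 = 0" "(antiderivative f has_real_derivative f x) (at x)"
    unfolding antiderivative_def by blast+
qed

lemma continuous_antiderivative:
  "continuous_on UNIV f \<Longrightarrow> continuous_on UNIV (antiderivative f)"
  using DERIV_isCont[OF antiderivative(2)] by (simp add: continuous_at_imp_continuous_on)

definition potential :: "(real \<Rightarrow> real) \<Rightarrow> real \<Rightarrow> real" where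
  "potential f = antiderivative (antiderivative f)"

lemma potential_has_derivative:
  "continuous_on UNIV f \<Longrightarrow> (potential f has_real_derivative antiderivative f x) (at x)"
  unfolding potential_def by (intro antiderivative continuous_antiderivative)

lemma continuous_potential:
  "continuous_on UNIV f \<Longrightarrow> continuous_on UNIV (potential f)"
  unfolding potential_def by (intro continuous_antiderivative)

text \<open>
  Two antiderivatives cost two factors \<open>\<bar>x\<bar>\<close>. On \<open>[- R, R]\<close> this turns uniform closeness of second
  derivatives into closeness of the potentials.
\<close>

lemma potential_diff_le:
  assumes "continuous_on UNIV f" "continuous_on UNIV g" and d: "\<And>x. \<bar>f x - g x\<bar> \<le> d"
  shows "\<bar>potential f x - potential g x\<bar> \<le> d * x\<^sup>2"
proof -
  have d0: "0 \<le> d" using d[of 0] by linarith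
  note fg = antiderivative[OF assms(1)] antiderivative[OF assms(2)]
    antiderivative[OF continuous_antiderivative[OF assms(1)]] antiderivative[OF continuous_antiderivative[OF assms(2)]]
  have 1: "\<bar>antiderivative f s - antiderivative g s\<bar> \<le> d * \<bar>s\<bar>" for s
    by (rule abs_le_of_deriv_le[of "\<lambda>s. antiderivative f s - antiderivative g s" "\<lambda>s. f s - g s"])
       (use fg d in \<open>auto intro!: derivative_intros\<close>)
  have "\<bar>potential f x - potential g x\<bar> \<le> (d * \<bar>x\<bar>) * \<bar>x\<bar>"
    unfolding potential_def
  proof (rule abs_le_of_deriv_le[of "\<lambda>s. antiderivative (antiderivative f) s - antiderivative (antiderivative g) s" 
         "\<lambda>s. antiderivative f s - antiderivative g s"])
    fix s :: real assume "\<bar>s\<bar> \<le> \<bar>x\<bar>"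
    then show "\<bar>antiderivative f s - antiderivative g s\<bar> \<le> d * \<bar>x\<bar>"
      using 1[of s] mult_left_mono[OF _ d0] order_trans by blast
  qed (use fg in \<open>auto intro!: derivative_intros\<close>)
  then show ?thesis by (simp add: power2_eq_square)
qed

lemma potential_le:
  assumes "continuous_on UNIV f" and d: "\<And>x. \<bar>f x\<bar> \<le> d"
  shows "\<bar>potential f x\<bar> \<le> d * x\<^sup>2"
proof -
  have 1: "\<bar>antiderivative f s\<bar> \<le> d * \<bar>s\<bar>" for s
    by (rule abs_le_of_deriv_le) (use antiderivative[OF assms(1)] d in auto)
  have d0: "0 \<le> d" using d[of 0] by linarith
  have "\<bar>potential f x\<bar> \<le> (d * \<bar>x\<bar>) * \<bar>x\<bar>"
    unfolding potential_def
  proof (rule abs_le_of_deriv_le)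
    fix s :: real assume "\<bar>s\<bar> \<le> \<bar>x\<bar>"
    then show "\<bar>antiderivative f s\<bar> \<le> d * \<bar>x\<bar>"
      using 1[of s] mult_left_mono[OF _ d0] order_trans by blast
  qed (use antiderivative continuous_antiderivative assms(1) in auto)
  then show ?thesis by (simp add: power2_eq_square)
qed

text \<open>
  The factor \<open>2 * M + 2\<close> is large enough that internal potentials of size \<open>x\<^sup>2\<close> cannot undo the
  confinement; the smallness condition on \<open>c\<close> yields both the invariance of a ball and the contraction.
\<close>

locale confined_plasma = p: profile \<mu>p c M + m: profile \<mu>m c M for \<mu>p \<mu>m c M +
  fixes R :: real and \<psi>ext :: "real \<Rightarrow> real"
  assumes M: "M \<ge> 0"
    and \<psi>ext: "continuous_on UNIV \<psi>ext"
    and confining: "\<bar>x\<bar> \<ge> R \<Longrightarrow> \<bar>\<psi>ext x\<bar> \<ge> (2 * M + 2) * (1 + x\<^sup>2)"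
    and small: "c * (16 * (measure lborel (velocity_box (M + 1)) + 1) * (1 + R\<^sup>2)) \<le> 1"
begin

abbreviation "K \<equiv> measure lborel (velocity_box (M + 1))"

text \<open>
  Charge density (\<open>w = 1\<close>) and second current component (\<open>w = vhat2\<close>) of both species together; \<open>a\<close> is
  the electric potential and \<open>b\<close> the total magnetic potential.
\<close>

definition source :: "(real \<times> real \<Rightarrow> real) \<Rightarrow> real \<Rightarrow> real \<Rightarrow> real" where
  "source w a b = velocity_moment w \<mu>p a b - velocity_moment w \<mu>m (- a) (- b)"

lemma confined:
  assumes "\<bar>x\<bar> \<ge> R" "\<bar>a\<bar> \<le> x\<^sup>2" "\<bar>b\<bar> \<le> x\<^sup>2"
  shows "\<bar>b + \<psi>ext x\<bar> > 2 * M + \<bar>a\<bar>"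
proof -
  have "(2 * M + 2) * (1 + x\<^sup>2) = 2 * M + 2 + 2 * (M * x\<^sup>2) + 2 * x\<^sup>2" by (simp add: algebra_simps)
  moreover have "0 \<le> M * x\<^sup>2" using M by simp
  ultimately show ?thesis using confining[OF assms(1)] assms(2,3) by linarith
qed

lemma source_eq_0:
  assumes "\<bar>x\<bar> \<ge> R" "\<bar>a\<bar> \<le> x\<^sup>2" "\<bar>b\<bar> \<le> x\<^sup>2"
  shows "source w a (b + \<psi>ext x) = 0"
proof -
  have "\<mu>p (jbracket v + a, snd v + (b + \<psi>ext x)) = 0" for v
    by (rule p.vanishes_for_large_momentum) (use confined[OF assms] in simp)
  moreover have "\<mu>m (jbracket v + - a, snd v + - (b + \<psi>ext x)) = 0" for v
    by (rule m.vanishes_for_large_momentum) (use confined[OF assms] in simp)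
  ultimately show ?thesis by (simp add: source_def velocity_moment_def del: minus_add_distrib)
qed

lemma source_bound:
  assumes "\<And>v. \<bar>w v\<bar> \<le> 1" "\<bar>a\<bar> \<le> 1"
  shows "\<bar>source w a b\<bar> \<le> 2 * c * K"
proof -
  have "\<bar>velocity_moment w \<mu>p a b\<bar> \<le> c * K" by (rule p.moment_bound[OF assms])
  moreover have "\<bar>velocity_moment w \<mu>m (- a) (- b)\<bar> \<le> c * K"
    by (rule m.moment_bound[OF assms(1)]) (use assms(2) in simp)
  ultimately show ?thesis unfolding source_def by linarith
qed

lemma source_Lipschitz:
  assumes "continuous_on UNIV w" "\<And>v. \<bar>w v\<bar> \<le> 1" "\<bar>a\<bar> \<le> 1" "\<bar>a'\<bar> \<le> 1"
  shows "\<bar>source w a b - source w a' b'\<bar> \<le> 2 * c * K * (\<bar>a - a'\<bar> + \<bar>b - b'\<bar>)"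
proof -
  have "\<bar>velocity_moment w \<mu>p a b - velocity_moment w \<mu>p a' b'\<bar> \<le> c * (\<bar>a - a'\<bar> + \<bar>b - b'\<bar>) * K"
    by (rule p.moment_Lipschitz[OF assms])
  moreover have "\<bar>velocity_moment w \<mu>m (- a) (- b) - velocity_moment w \<mu>m (- a') (- b')\<bar> \<le>
      c * (\<bar>a - a'\<bar> + \<bar>b - b'\<bar>) * K"
  proof -
    have e: "\<bar>- a - - a'\<bar> = \<bar>a - a'\<bar>" "\<bar>- b - - b'\<bar> = \<bar>b - b'\<bar>" by linarith+
    show ?thesis
      using m.moment_Lipschitz[OF assms(1,2), of "- a" 1 "- a'" "- b" "- b'"] assms(3,4) unfolding e by simp
  qed
  moreover have "2 * c * K * (\<bar>a - a'\<bar> + \<bar>b - b'\<bar>) = 2 * (c * (\<bar>a - a'\<bar> + \<bar>b - b'\<bar>) * K)" by simp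
  ultimately show ?thesis unfolding source_def by (simp only:) linarith
qed

text \<open>
  The unknown of the fixed point problem is the pair \<open>y\<close> of second derivatives of the two potentials,
  rather than the potentials themselves: a fixed point is bounded on the whole line, whereas the
  potentials are affine outside \<open>[- R, R]\<close> and in general unbounded.
\<close>

definition field_map :: "(real \<Rightarrow>\<^sub>C (real \<times> real)) \<Rightarrow> real \<Rightarrow> real \<times> real" where
  "field_map y x = (let a = potential (\<lambda>x. fst (apply_bcontfun y x)) x; b = potential (\<lambda>x. snd (apply_bcontfun y x)) x + \<psi>ext x
     in (- source (\<lambda>v. 1) a b, - source vhat2 a b))"

text \<open>
  Radius of the ball of second derivatives: it makes the potentials at most \<open>x\<^sup>2\<close> everywhere, as
  needed for confinement, and at most \<open>1\<close> on \<open>[- R, R]\<close>, as needed for a fixed velocity box.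
\<close>

definition r :: real where "r = 1 / (1 + R\<^sup>2)"

lemma r: "0 < r" "r \<le> 1" "r * R\<^sup>2 \<le> 1"
  by (auto simp: r_def add_pos_nonneg divide_simps)

text \<open>
  Both components of \<open>field_map\<close> are differences of two moments, whence the factor \<open>4\<close>. The first
  bound keeps \<open>field_map\<close> in the ball of radius \<open>r\<close>. The second makes it a contraction: elements of the
  ball at distance \<open>d\<close> have potentials differing by at most \<open>d * R\<^sup>2\<close> on \<open>[- R, R]\<close>, once for each of the
  two potentials.
\<close>

lemma cK: "4 * c * K \<le> r" "8 * c * K * R\<^sup>2 \<le> 1 / 2"
proof -
  have c: "c \<ge> 0" by (rule p.c_nonneg)
  have K: "K \<ge> 0" by simp
  have "1 + R\<^sup>2 > 0" by (simp add: add_pos_nonneg)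
  have "c * K * (1 + R\<^sup>2) \<le> c * (K + 1) * (1 + R\<^sup>2)"
    using c by (intro mult_right_mono mult_left_mono) auto
  also have "\<dots> \<le> 1 / 16" using small by (simp add: algebra_simps)
  finally have *: "c * K * (1 + R\<^sup>2) \<le> 1 / 16" .
  then have "4 * c * K * (1 + R\<^sup>2) \<le> 1" by simp
  then show "4 * c * K \<le> r" unfolding r_def using \<open>1 + R\<^sup>2 > 0\<close> by (simp add: pos_le_divide_eq)
  have "c * K * R\<^sup>2 \<le> c * K * (1 + R\<^sup>2)" using c K by (intro mult_left_mono) auto
  with * show "8 * c * K * R\<^sup>2 \<le> 1 / 2" by linarith
qed

lemma sq_le_R: "\<bar>x\<bar> \<le> R \<Longrightarrow> x\<^sup>2 \<le> R\<^sup>2"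
  by (metis abs_ge_zero abs_le_square_iff abs_of_nonneg order_trans)

lemma components:
  fixes y z :: "real \<Rightarrow>\<^sub>C (real \<times> real)"
  shows "continuous_on UNIV (\<lambda>x. fst (apply_bcontfun y x))" "continuous_on UNIV (\<lambda>x. snd (apply_bcontfun y x))"
    "\<bar>fst (apply_bcontfun y x) - fst (apply_bcontfun z x)\<bar> \<le> dist y z" "\<bar>snd (apply_bcontfun y x) - snd (apply_bcontfun z x)\<bar> \<le> dist y z"
    "y \<in> cball 0 r \<Longrightarrow> \<bar>fst (apply_bcontfun y x)\<bar> \<le> r" "y \<in> cball 0 r \<Longrightarrow> \<bar>snd (apply_bcontfun y x)\<bar> \<le> r"
proof -
  show "continuous_on UNIV (\<lambda>x. fst (apply_bcontfun y x))" "continuous_on UNIV (\<lambda>x. snd (apply_bcontfun y x))"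
    by (intro continuous_on_fst continuous_on_snd continuous_on_apply_bcontfun)+
  have *: "dist (apply_bcontfun y x) (apply_bcontfun z x) \<le> dist y z" for z by (rule dist_bounded)
  show "\<bar>fst (apply_bcontfun y x) - fst (apply_bcontfun z x)\<bar> \<le> dist y z" "\<bar>snd (apply_bcontfun y x) - snd (apply_bcontfun z x)\<bar> \<le> dist y z"
    using *[of z] dist_fst_le[of "apply_bcontfun y x" "apply_bcontfun z x"] dist_snd_le[of "apply_bcontfun y x" "apply_bcontfun z x"] by (auto simp: dist_real_def)
  show "\<bar>fst (apply_bcontfun y x)\<bar> \<le> r" "\<bar>snd (apply_bcontfun y x)\<bar> \<le> r" if "y \<in> cball 0 r"
    using that *[of 0] dist_fst_le[of "apply_bcontfun y x" 0] dist_snd_le[of "apply_bcontfun y x" 0]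
    by (auto simp: dist_real_def dist_commute)
qed

lemma potentials_le:
  assumes "y \<in> cball 0 r"
  shows "\<bar>potential (\<lambda>x. fst (apply_bcontfun y x)) x\<bar> \<le> r * x\<^sup>2" "\<bar>potential (\<lambda>x. snd (apply_bcontfun y x)) x\<bar> \<le> r * x\<^sup>2"
    "\<bar>potential (\<lambda>x. fst (apply_bcontfun y x)) x\<bar> \<le> x\<^sup>2" "\<bar>potential (\<lambda>x. snd (apply_bcontfun y x)) x\<bar> \<le> x\<^sup>2"
    "\<bar>x\<bar> \<le> R \<Longrightarrow> \<bar>potential (\<lambda>x. fst (apply_bcontfun y x)) x\<bar> \<le> 1"
proof -
  show 1: "\<bar>potential (\<lambda>x. fst (apply_bcontfun y x)) x\<bar> \<le> r * x\<^sup>2" "\<bar>potential (\<lambda>x. snd (apply_bcontfun y x)) x\<bar> \<le> r * x\<^sup>2"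
    by (intro potential_le components assms)+
  have "r * x\<^sup>2 \<le> x\<^sup>2" using r by (simp add: mult_left_le_one_le)
  with 1 show "\<bar>potential (\<lambda>x. fst (apply_bcontfun y x)) x\<bar> \<le> x\<^sup>2" "\<bar>potential (\<lambda>x. snd (apply_bcontfun y x)) x\<bar> \<le> x\<^sup>2" by linarith+
  assume "\<bar>x\<bar> \<le> R"
  then have "r * x\<^sup>2 \<le> r * R\<^sup>2" using sq_le_R r by (intro mult_left_mono) auto
  with 1(1) r(3) show "\<bar>potential (\<lambda>x. fst (apply_bcontfun y x)) x\<bar> \<le> 1" by linarith
qed

text \<open>
  Outside \<open>[- R, R]\<close> there are no particles, whatever the element of the ball. Hence the estimates
  for \<open>field_map\<close> have to be proved on a bounded interval only, where the potentials are small.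
\<close>

lemma field_map_eq_0:
  "y \<in> cball 0 r \<Longrightarrow> \<bar>x\<bar> \<ge> R \<Longrightarrow> field_map y x = 0"
  unfolding field_map_def Let_def by (simp add: source_eq_0 potentials_le zero_prod_def)

lemma weights: "continuous_on UNIV (\<lambda>v. vhat2 v)" "continuous_on UNIV (\<lambda>v::real \<times> real. 1::real)"
  "\<And>v. \<bar>vhat2 v\<bar> \<le> 1" "\<And>v::real \<times> real. \<bar>1::real\<bar> \<le> 1"
  by (intro continuous_intros continuous_vhat abs_vhat_le_1 | simp)+

lemma norm_pair_le: "norm (a, b) \<le> \<bar>a\<bar> + \<bar>b\<bar>" for a b :: real
  using norm_Pair_le[of a b] by simp

lemma field_map_bound:
  assumes "y \<in> cball 0 r"
  shows "norm (field_map y x) \<le> r"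
proof (cases "\<bar>x\<bar> \<ge> R")
  case True then show ?thesis using field_map_eq_0[OF assms] r by simp
next
  case False
  then have a: "\<bar>potential (\<lambda>x. fst (apply_bcontfun y x)) x\<bar> \<le> 1" using potentials_le[OF assms] by simp
  have "norm (field_map y x) \<le> 2 * c * K + 2 * c * K"
    unfolding field_map_def Let_def
    by (rule order_trans[OF norm_pair_le], rule add_mono)
       (simp_all only: abs_minus_cancel, (intro source_bound a weights)+)
  then show ?thesis using cK(1) by linarith
qed

lemma continuous_field_map: "continuous_on UNIV (field_map y)"
proof -
  note c = continuous_potential[OF components(1)] continuous_potential[OF components(2)]
  show ?thesis unfolding field_map_def Let_def source_def
    by (intro continuous_intros p.continuous_moment m.continuous_moment weights c \<psi>ext)
qed

lemma field_map_contraction: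
  assumes y: "y \<in> cball 0 r" and z: "z \<in> cball 0 r"
  shows "dist (field_map y x) (field_map z x) \<le> 1 / 2 * dist y z"
proof (cases "\<bar>x\<bar> \<ge> R")
  case True then show ?thesis using field_map_eq_0 y z by simp
next
  case False
  then have x: "\<bar>x\<bar> \<le> R" by simp
  define d where "d = dist y z"
  define \<phi>y \<phi>z \<psi>y \<psi>z where "\<phi>y = potential (\<lambda>x. fst (apply_bcontfun y x)) x" and "\<phi>z = potential (\<lambda>x. fst (apply_bcontfun z x)) x"
    and "\<psi>y = potential (\<lambda>x. snd (apply_bcontfun y x)) x" and "\<psi>z = potential (\<lambda>x. snd (apply_bcontfun z x)) x"
  have dR: "d * x\<^sup>2 \<le> d * R\<^sup>2" using sq_le_R[OF x] by (intro mult_left_mono) (auto simp: d_def)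
  have "\<bar>\<phi>y - \<phi>z\<bar> \<le> d * x\<^sup>2" "\<bar>\<psi>y - \<psi>z\<bar> \<le> d * x\<^sup>2"
    unfolding \<phi>y_def \<phi>z_def \<psi>y_def \<psi>z_def d_def by (intro potential_diff_le components)+
  then have diff: "\<bar>\<phi>y - \<phi>z\<bar> + \<bar>\<psi>y + \<psi>ext x - (\<psi>z + \<psi>ext x)\<bar> \<le> 2 * (d * R\<^sup>2)" using dR by simp
  have a: "\<bar>\<phi>y\<bar> \<le> 1" "\<bar>\<phi>z\<bar> \<le> 1" unfolding \<phi>y_def \<phi>z_def using potentials_le y z x by blast+
  have "\<bar>source w \<phi>y (\<psi>y + \<psi>ext x) - source w \<phi>z (\<psi>z + \<psi>ext x)\<bar> \<le> 2 * c * K * (2 * (d * R\<^sup>2))"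
    if w: "continuous_on UNIV w" "\<And>v. \<bar>w v\<bar> \<le> 1" for w
  proof -
    have "0 \<le> 2 * c * K" using p.c_nonneg by simp
    from order_trans[OF source_Lipschitz[OF w a] mult_left_mono[OF diff this]] show ?thesis .
  qed
  note s = this[OF weights(2,4)] this[OF weights(1,3)]
  have "dist (field_map y x) (field_map z x) \<le> 
     \<bar>source (\<lambda>v. 1) \<phi>y (\<psi>y + \<psi>ext x) - source (\<lambda>v. 1) \<phi>z (\<psi>z + \<psi>ext x)\<bar> +
     \<bar>source vhat2 \<phi>y (\<psi>y + \<psi>ext x) - source vhat2 \<phi>z (\<psi>z + \<psi>ext x)\<bar>"
    unfolding field_map_def Let_def \<phi>y_def \<phi>z_def \<psi>y_def \<psi>z_def
    by (simp add: dist_norm) (rule order_trans[OF norm_pair_le], simp)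
  also have "\<dots> \<le> (8 * c * K * R\<^sup>2) * d" using s by (simp add: algebra_simps)
  also have "\<dots> \<le> 1 / 2 * d" using cK(2) by (intro mult_right_mono) (auto simp: d_def)
  finally show ?thesis by (simp add: d_def)
qed

text \<open>
  Banach's fixed point theorem on a ball of bounded continuous functions. The potentials of the fixed
  point have continuous second derivatives by construction.
\<close>

lemma self_consistent_potentials:
  obtains \<phi> \<phi>' \<phi>'' \<psi> \<psi>' \<psi>'' :: "real \<Rightarrow> real"
  where "\<And>x. (\<phi> has_real_derivative \<phi>' x) (at x)" "\<And>x. (\<phi>' has_real_derivative \<phi>'' x) (at x)"
    "\<And>x. (\<psi> has_real_derivative \<psi>' x) (at x)" "\<And>x. (\<psi>' has_real_derivative \<psi>'' x) (at x)"
    "continuous_on UNIV \<phi>''" "continuous_on UNIV \<psi>''"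
    "\<And>x. \<phi>'' x = - source (\<lambda>v. 1) (\<phi> x) (\<psi> x + \<psi>ext x)"
    "\<And>x. \<psi>'' x = - source vhat2 (\<phi> x) (\<psi> x + \<psi>ext x)"
    "\<And>x. \<bar>\<phi> x\<bar> \<le> x\<^sup>2" "\<And>x. \<bar>\<psi> x\<bar> \<le> x\<^sup>2"
proof -
  define F where "F y = Bcontfun (field_map y)" for y
  have F: "apply_bcontfun (F y) = field_map y" if "y \<in> cball 0 r" for y
    unfolding F_def
    by (rule Bcontfun_inverse, rule bcontfun_normI[OF continuous_field_map field_map_bound[OF that]])
  have "\<exists>!y. y \<in> cball 0 r \<and> F y = y"
  proof (rule Banach_fix)
    show "complete (cball (0 :: real \<Rightarrow>\<^sub>C (real \<times> real)) r)" by (simp add: complete_eq_closed)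
    show "cball (0 :: real \<Rightarrow>\<^sub>C (real \<times> real)) r \<noteq> {}" using r by simp
    show "F ` cball 0 r \<subseteq> cball 0 r"
    proof (rule image_subsetI)
      fix y :: "real \<Rightarrow>\<^sub>C (real \<times> real)" assume y: "y \<in> cball 0 r"
      have "norm (F y) \<le> r" by (rule norm_bound) (simp add: F[OF y] field_map_bound[OF y])
      then show "F y \<in> cball 0 r" by simp
    qed
    show "dist (F y) (F z) \<le> 1 / 2 * dist y z" if "y \<in> cball 0 r" "z \<in> cball 0 r" for y z
      by (rule dist_bound) (use field_map_contraction that F in simp)
  qed auto
  then obtain y where y: "y \<in> cball 0 r" "F y = y" by blast
  then have fix_eq: "apply_bcontfun y x = field_map y x" for x using F[OF y(1)] by simp
  show thesis
  proof (rule that)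
    show "(potential (\<lambda>x. fst (apply_bcontfun y x)) has_real_derivative antiderivative (\<lambda>x. fst (apply_bcontfun y x)) x) (at x)"
      "(potential (\<lambda>x. snd (apply_bcontfun y x)) has_real_derivative antiderivative (\<lambda>x. snd (apply_bcontfun y x)) x) (at x)" for x
      by (intro potential_has_derivative components)+
    show "(antiderivative (\<lambda>x. fst (apply_bcontfun y x)) has_real_derivative fst (apply_bcontfun y x)) (at x)"
      "(antiderivative (\<lambda>x. snd (apply_bcontfun y x)) has_real_derivative snd (apply_bcontfun y x)) (at x)" for x
      by (intro antiderivative components)+
    show "fst (apply_bcontfun y x) = - source (\<lambda>v. 1) (potential (\<lambda>x. fst (apply_bcontfun y x)) x) (potential (\<lambda>x. snd (apply_bcontfun y x)) x + \<psi>ext x)" for x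
      by (subst fix_eq) (simp add: field_map_def Let_def)
    show "snd (apply_bcontfun y x) = - source vhat2 (potential (\<lambda>x. fst (apply_bcontfun y x)) x) (potential (\<lambda>x. snd (apply_bcontfun y x)) x + \<psi>ext x)" for x
      by (subst fix_eq) (simp add: field_map_def Let_def)
  qed (use components potentials_le[OF y(1)] in auto)
qed

end

section \<open>Existence of confined equilibria\<close>

theorem proposition7p1:
  fixes R \<alpha> :: real and Ap Am :: "(real \<times> real) set"
  assumes "R > 0" and "\<alpha> > 2" and "bounded_domain Ap" and "bounded_domain Am"
  shows "\<exists>c C. c > 0 \<and> C > 0 \<and>
    (\<forall>\<mu>p \<mu>m :: real \<times> real \<Rightarrow> real. \<forall>\<psi>ext :: real \<Rightarrow> real.
       C1_0 \<mu>p \<and> fun_support \<mu>p \<subseteq> Ap \<and> decay_bound c \<alpha> \<mu>p \<and>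
       C1_0 \<mu>m \<and> fun_support \<mu>m \<subseteq> Am \<and> decay_bound c \<alpha> \<mu>m \<and>
       H2_loc \<psi>ext \<and> (\<forall>x. \<bar>x\<bar> \<ge> R \<longrightarrow> \<bar>\<psi>ext x\<bar> \<ge> C * (1 + \<bar>x\<bar>\<^sup>2))
       \<longrightarrow>
       (\<exists>\<phi>0 \<psi>0 :: real \<Rightarrow> real. H2_loc \<phi>0 \<and> H2_loc \<psi>0 \<and>
          (let f0p = (\<lambda>x v. \<mu>p (micro_energy 1 \<phi>0 x v, micro_momentum 1 \<psi>0 \<psi>ext x v));
               f0m = (\<lambda>x v. \<mu>m (micro_energy (-1) \<phi>0 x v, micro_momentum (-1) \<psi>0 \<psi>ext x v))
           in RVM_equilibrium f0p f0m \<phi>0 \<psi>0 \<psi>ext (\<lambda>x. 0) \<and> spatial_support_in f0p f0m R)))"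
proof -
  have "bounded (Ap \<union> Am)" using assms by (simp add: bounded_domain_def)
  then obtain M where M: "M > 0" "\<And>z. z \<in> Ap \<union> Am \<Longrightarrow> norm z \<le> M"
    unfolding bounded_pos by blast
  define K where "K = measure lborel (velocity_box (M + 1))"
  have K: "K \<ge> 0" by (simp add: K_def)
  \<comment> \<open>With \<open>16\<close> both smallness requirements on \<open>c\<close> hold; \<open>K + 1\<close> instead of \<open>K\<close> avoids a separate argument that the velocity box has positive measure.\<close>
  define c where "c = 1 / (16 * (K + 1) * (1 + R\<^sup>2))"
  have pos: "16 * (K + 1) * (1 + R\<^sup>2) > 0" using K by (intro mult_pos_pos) (auto simp: add_nonneg_pos add_pos_nonneg)
  then have c: "c > 0" "c * (16 * (K + 1) * (1 + R\<^sup>2)) = 1" unfolding c_def by auto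
  have profileI: "profile \<mu> c M" if \<mu>: "C1_0 \<mu>" "fun_support \<mu> \<subseteq> Ap \<union> Am" "decay_bound c \<alpha> \<mu>" for \<mu>
  proof
    have C1: "C1 \<mu>" using \<mu> by (simp add: C1_0_def)
    show "continuous_on UNIV \<mu>" using C1 by (rule C1_imp_continuous)
    have "\<alpha> \<ge> 0" "c \<ge> 0" using assms c by auto
    note bounds = decay_bound_imp_bounded(1)[OF \<mu>(3) this] decay_bound_imp_Lipschitz[OF C1 \<mu>(3) this]
    show "\<bar>\<mu> z\<bar> \<le> c" "\<bar>\<mu> (e, p) - \<mu> (e', p')\<bar> \<le> c * (\<bar>e - e'\<bar> + \<bar>p - p'\<bar>)" for z e p e' p'
      by (rule bounds)+
    have "\<bar>e\<bar> \<le> M \<and> \<bar>p\<bar> \<le> M" if "\<mu> (e, p) \<noteq> 0" for e p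
    proof -
      have "(e, p) \<in> fun_support \<mu>" unfolding fun_support_def
        by (rule subsetD[OF closure_subset]) (use that in simp)
      then have "norm (e, p) \<le> M" using \<mu>(2) M(2) by blast
      then show ?thesis using norm_fst_le[of e p] norm_snd_le[of p e] by auto
    qed
    then show "\<mu> (e, p) \<noteq> 0 \<Longrightarrow> \<bar>e\<bar> \<le> M \<and> \<bar>p\<bar> \<le> M" for e p by blast
  qed
  show ?thesis
  proof (rule exI[of _ c], rule exI[of _ "2 * M + 2"], intro conjI allI impI)
    show "c > 0" "2 * M + 2 > 0" using c M by auto
    fix \<mu>p \<mu>m :: "real \<times> real \<Rightarrow> real" and \<psi>ext :: "real \<Rightarrow> real"
    assume asm: "C1_0 \<mu>p \<and> fun_support \<mu>p \<subseteq> Ap \<and> decay_bound c \<alpha> \<mu>p \<and>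
       C1_0 \<mu>m \<and> fun_support \<mu>m \<subseteq> Am \<and> decay_bound c \<alpha> \<mu>m \<and>
       H2_loc \<psi>ext \<and> (\<forall>x. \<bar>x\<bar> \<ge> R \<longrightarrow> \<bar>\<psi>ext x\<bar> \<ge> (2 * M + 2) * (1 + \<bar>x\<bar>\<^sup>2))"
    have pr: "profile \<mu>p c M" "profile \<mu>m c M" using asm by (auto intro!: profileI)
    have \<psi>ext_C1: "\<And>x. (\<psi>ext has_real_derivative deriv \<psi>ext x) (at x)" "continuous_on UNIV (deriv \<psi>ext)"
      using H2_loc_imp_C1[of \<psi>ext] asm by blast+
    interpret p: profile \<mu>p c M by fact
    interpret m: profile \<mu>m c M by fact
    interpret confined_plasma \<mu>p \<mu>m c M R \<psi>ext
      by unfold_locales (use M asm c in \<open>auto simp: K_def H2_loc_def\<close>)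
    obtain \<phi> \<phi>' \<phi>'' \<psi> \<psi>' \<psi>'' :: "real \<Rightarrow> real" where
      \<phi>: "\<And>x. (\<phi> has_real_derivative \<phi>' x) (at x)" "\<And>x. (\<phi>' has_real_derivative \<phi>'' x) (at x)" and
      \<psi>: "\<And>x. (\<psi> has_real_derivative \<psi>' x) (at x)" "\<And>x. (\<psi>' has_real_derivative \<psi>'' x) (at x)" and
      cont: "continuous_on UNIV \<phi>''" "continuous_on UNIV \<psi>''" and
      eqs: "\<And>x. \<phi>'' x = - source (\<lambda>v. 1) (\<phi> x) (\<psi> x + \<psi>ext x)"
        "\<And>x. \<psi>'' x = - source vhat2 (\<phi> x) (\<psi> x + \<psi>ext x)" and
      growth: "\<And>x. \<bar>\<phi> x\<bar> \<le> x\<^sup>2" "\<And>x. \<bar>\<psi> x\<bar> \<le> x\<^sup>2"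
      by (rule self_consistent_potentials) blast
    have H2: "H2_loc \<phi>" "H2_loc \<psi>"
      using C2_imp_H2_loc[OF \<phi> cont(1)] C2_imp_H2_loc[OF \<psi> cont(2)] by auto
    have C1: "C1 \<mu>p" "C1 \<mu>m" using asm by (auto simp: C1_0_def)
    have eq: "RVM_equilibrium (\<lambda>x v. \<mu>p (micro_energy 1 \<phi> x v, micro_momentum 1 \<psi> \<psi>ext x v))
      (\<lambda>x v. \<mu>m (micro_energy (-1) \<phi> x v, micro_momentum (-1) \<psi> \<psi>ext x v)) \<phi> \<psi> \<psi>ext (\<lambda>x. 0)"
      by (rule equilibrium_of_potentials[OF C1 pr \<phi> \<psi> cont \<psi>ext_C1]) (simp_all only: eqs source_def)
    have "spatial_support_in (\<lambda>x v. \<mu>p (micro_energy 1 \<phi> x v, micro_momentum 1 \<psi> \<psi>ext x v))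
      (\<lambda>x v. \<mu>m (micro_energy (-1) \<phi> x v, micro_momentum (-1) \<psi> \<psi>ext x v)) R"
      unfolding spatial_support_in_def
    proof (intro allI impI)
      fix x v assume "\<bar>x\<bar> > R"
      then have "\<bar>\<psi> x + \<psi>ext x\<bar> > 2 * M + \<bar>\<phi> x\<bar>" using growth by (intro confined) auto
      then show "\<mu>p (micro_energy 1 \<phi> x v, micro_momentum 1 \<psi> \<psi>ext x v) = 0 \<and>
        \<mu>m (micro_energy (-1) \<phi> x v, micro_momentum (-1) \<psi> \<psi>ext x v) = 0"
        using p.vanishes_for_large_momentum[of "\<phi> x" "\<psi> x + \<psi>ext x" v]
          m.vanishes_for_large_momentum[of "- \<phi> x" "- (\<psi> x + \<psi>ext x)" v]
        by (simp add: micro_energy_def micro_momentum_def algebra_simps)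
    qed
    with H2 eq show "\<exists>\<phi>0 \<psi>0 :: real \<Rightarrow> real. H2_loc \<phi>0 \<and> H2_loc \<psi>0 \<and>
          (let f0p = (\<lambda>x v. \<mu>p (micro_energy 1 \<phi>0 x v, micro_momentum 1 \<psi>0 \<psi>ext x v));
               f0m = (\<lambda>x v. \<mu>m (micro_energy (-1) \<phi>0 x v, micro_momentum (-1) \<psi>0 \<psi>ext x v))
           in RVM_equilibrium f0p f0m \<phi>0 \<psi>0 \<psi>ext (\<lambda>x. 0) \<and> spatial_support_in f0p f0m R)"
      unfolding Let_def by blast
  qed
qed

end
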